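(* Let $p\in\mathfrak{P}(\mathbb{T})$. Suppose that either ($p_+<\infty$ and $p\in LH_0(\mathbb{T})$) or $p'\in\mathfrak{K}(\mathbb{T})$. Then the set of analytic polynomials $\mathcal{P}_A$ is dense in the abstract Hardy space $H[L^{p(\cdot)}]$ built upon the variable Lebesgue space $L^{p(\cdot)}$ (with respect to the norm of $L^{p(\cdot)}$).
   Context: $\mathbb{T}=\{z\in\mathbb{C}:|z|=1\}$ is equipped with the normalized Lebesgue measure $dm(t)=|dt|/(2\pi)$; functions equal a.e. are identified; $L^1=L^1(\mathbb{T})$. Variable Lebesgue spaces: $\mathfrak{P}(\mathbb{T})$ is the set of all measurable functions $p:\mathbb{T}\to[1,\infty]$. For $p\in\mathfrak{P}(\mathbb{T})$ put $\mathbb{T}_\infty^{p(\cdot)}:=\{t\in\mathbb{T}:p(t)=\infty\}$, $p_-:=\operatorname{ess\,inf}_{t\in\mathbb{T}}p(t)$, $p_+:=\operatorname{ess\,sup}_{t\in\mathbb{T}}p(t)$, and for measurable $f:\mathbb{T}\to\mathbb{C}$ let $\varrho_{p(\cdot)}(f):=\int_{\mathbb{T}\setminus\mathbb{T}_\infty^{p(\cdot)}}|f(t)|^{p(t)}\,dm(t)+\|f\|_{L^\infty(\mathbb{T}_\infty^{p(\cdot)})}$. $L^{p(\cdot)}$ is the set of all measurable $f:\mathbb{T}\to\mathbb{C}$ with $\varrho_{p(\cdot)}(f/\lambda)<\infty$ for some $\lambda>0$, normed by $\|f\|_{L^{p(\cdot)}}:=\inf\{\lambda>0:\varrho_{p(\cdot)}(f/\lambda)\le1\}$.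 It is a Banach space continuously embedded in $L^1$. The exponent $p'\in\mathfrak{P}(\mathbb{T})$ is defined by $1/p(t)+1/p'(t)=1$ for a.e. $t\in\mathbb{T}$, with $1/\infty:=0$. $LH_0(\mathbb{T})$ is the class of locally log-Hölder continuous functions: $r:\mathbb{T}\to\mathbb{R}$ for which there is a constant $C_0>0$ with $|r(x)-r(y)|\le C_0/(-\log|x-y|)$ for all $x,y\in\mathbb{T}$ with $|x-y|<1/2$. For an arc $I\subset\mathbb{T}$ and $f\in L^1$ let $f_I:=\frac1{m(I)}\int_If\,dm$. $f\in L^1$ belongs to $BMO$ if $\sup_{I\subset\mathbb{T}}\frac1{m(I)}\int_I|f(t)-f_I|\,dm(t)<\infty$ (supremum over all arcs). For $f\in BMO$ put $\gamma(f,r):=\sup_{m(I)\le r}\frac1{m(I)}\int_I|f(t)-f_I|\,dm(t)$. $VMO^{1/|\log|}$ is the set of $f\in BMO$ with $\gamma(f,r)=o(1/|\log r|)$ as $r\to0$. An exponent $q\in\mathfrak{P}(\mathbb{T})$ belongs to the Kapanadze-Kopaliani class $\mathfrak{K}(\mathbb{T})$ if $1<q_-\le q_+<\infty$ and $q\in VMO^{1/|\log|}$. For $f\in L^1$, $\widehat f(n):=\frac1{2\pi}\int_{-\pi}^{\pi}f(e^{i\varphi})e^{-in\varphi}\,d\varphi$, $n\in\mathbb{Z}$. For a Banach space $X$ continuously embedded in $L^1$, $H[X]:=\{f\in X:\widehat f(n)=0\text{ for all }n<0\}$. $\mathcal{P}_A$ is the set of analytic polynomials, i.e. functions $q(t)=\sum_{k=0}^n\alpha_kt^k$,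 $t\in\mathbb{T}$, with $\alpha_0,\dots,\alpha_n\in\mathbb{C}$. *)

theory Defs
  imports
    "HOL-Probability.Essential_Supremum"
    "HOL-Library.Landau_Symbols"
    "HOL-Computational_Algebra.Polynomial"
begin

text \<open>Functions on the unit circle are total functions on \<^typ>\<open>complex\<close>; only their values on
  \<^term>\<open>sphere 0 1 :: complex set\<close>, the space of the following measure, matter.
  The completion makes measurability mean Lebesgue measurability.\<close>

definition circle_measure :: "complex measure" where
  "circle_measure =
     completion (distr (uniform_measure lborel {-pi..pi}) (restrict_space borel (sphere 0 1)) cis)"

subsection \<open>Variable Lebesgue spaces\<close>

definition exponents :: "(complex \<Rightarrow> ennreal) set" where
  "exponents = {p. p \<in> borel_measurable circle_measure \<and> (\<forall>t\<in>sphere 0 1. 1 \<le> p t)}"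

definition essinf :: "'a measure \<Rightarrow> ('a \<Rightarrow> ennreal) \<Rightarrow> ennreal" where
  "essinf M f = Sup {c. AE x in M. c \<le> f x}"

definition infinity_set :: "(complex \<Rightarrow> ennreal) \<Rightarrow> complex set" where
  "infinity_set p = {t \<in> sphere 0 1. p t = \<infinity>}"

text \<open>The essential supremum is taken in \<^typ>\<open>ennreal\<close>, so that it is \<open>0\<close> when the set where
  \<open>p = \<infinity>\<close> is null.\<close>

definition modular :: "(complex \<Rightarrow> ennreal) \<Rightarrow> (complex \<Rightarrow> complex) \<Rightarrow> ennreal" where
  "modular p f =
     (\<integral>\<^sup>+t\<in>sphere 0 1 - infinity_set p. ennreal (norm (f t) powr enn2real (p t)) \<partial>circle_measure)
     + esssup (restrict_space circle_measure (infinity_set p)) (\<lambda>t. ennreal (norm (f t)))"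

definition Lvar :: "(complex \<Rightarrow> ennreal) \<Rightarrow> (complex \<Rightarrow> complex) set" where
  "Lvar p = {f \<in> borel_measurable circle_measure.
     \<exists>c>0. modular p (\<lambda>t. f t / complex_of_real c) < \<infinity>}"

definition Lvar_norm :: "(complex \<Rightarrow> ennreal) \<Rightarrow> (complex \<Rightarrow> complex) \<Rightarrow> real" where
  "Lvar_norm p f = Inf {c. c > 0 \<and> modular p (\<lambda>t. f t / complex_of_real c) \<le> 1}"

text \<open>\<open>1/\<infinity> = 0\<close> and \<open>1/0 = \<infinity>\<close> hold in \<^typ>\<open>ennreal\<close>.\<close>

definition conjugate_exponents :: "(complex \<Rightarrow> ennreal) \<Rightarrow> (complex \<Rightarrow> ennreal) \<Rightarrow> bool" where
  "conjugate_exponents p p' \<longleftrightarrow> p \<in> exponents \<and> p' \<in> exponents \<and>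
     (AE t in circle_measure. 1 / p t + 1 / p' t = 1)"

subsection \<open>Regularity classes of exponents\<close>

text \<open>The case \<open>x = y\<close> is harmless: \<open>ln 0 = 0\<close> and division by \<open>0\<close> gives \<open>0\<close>, so the
  inequality reads \<open>0 \<le> 0\<close>.\<close>

definition LH0 :: "(complex \<Rightarrow> real) set" where
  "LH0 = {r. \<exists>C>0. \<forall>x\<in>sphere 0 1. \<forall>y\<in>sphere 0 1.
     norm (x - y) < 1/2 \<longrightarrow> \<bar>r x - r y\<bar> \<le> C / (- ln (norm (x - y)))}"

text \<open>Nondegenerate closed arcs, up to the full circle. Including or omitting end points changes
  an arc only by a null set, hence none of the means below.\<close>

definition arcs :: "complex set set" where
  "arcs = {cis ` {a..b} |a b. a < b \<and> b \<le> a + 2 * pi}"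

definition arc_mean :: "complex set \<Rightarrow> (complex \<Rightarrow> 'a::{banach,second_countable_topology}) \<Rightarrow> 'a" where
  "arc_mean I f = (1 / measure circle_measure I) *\<^sub>R (LINT t:I|circle_measure. f t)"

definition mean_oscillation ::
    "(complex \<Rightarrow> 'a::{banach,second_countable_topology}) \<Rightarrow> complex set \<Rightarrow> real" where
  "mean_oscillation f I = arc_mean I (\<lambda>t. norm (f t - arc_mean I f))"

definition BMO :: "(complex \<Rightarrow> 'a::{banach,second_countable_topology}) set" where
  "BMO = {f. integrable circle_measure f \<and> bdd_above (mean_oscillation f ` arcs)}"

definition osc_modulus :: "(complex \<Rightarrow> 'a::{banach,second_countable_topology}) \<Rightarrow> real \<Rightarrow> real" where
  "osc_modulus f r = (SUP I\<in>{I \<in> arcs. measure circle_measure I \<le> r}. mean_oscillation f I)"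

definition VMO_log :: "(complex \<Rightarrow> 'a::{banach,second_countable_topology}) set" where
  "VMO_log = {f \<in> BMO. osc_modulus f \<in> o[at_right 0](\<lambda>r. 1 / \<bar>ln r\<bar>)}"

text \<open>\<^const>\<open>enn2real\<close> maps \<open>\<infinity>\<close> to \<open>0\<close>, which matters only on a null set here because the
  essential supremum is finite.\<close>

definition Kapanadze_Kopaliani :: "(complex \<Rightarrow> ennreal) set" where
  "Kapanadze_Kopaliani = {q \<in> exponents.
     1 < essinf circle_measure q \<and> essinf circle_measure q \<le> esssup circle_measure q \<and>
     esssup circle_measure q < \<infinity> \<and> (\<lambda>t. enn2real (q t)) \<in> VMO_log}"

subsection \<open>Abstract Hardy spaces\<close>

text \<open>The integral is over \<^const>\<open>lebesgue\<close>, not \<^const>\<open>lborel\<close>, since \<open>f\<close> need only be Lebesgue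
  measurable.\<close>

definition fourier_coeff :: "(complex \<Rightarrow> complex) \<Rightarrow> int \<Rightarrow> complex" where
  "fourier_coeff f n = 1 / (2 * complex_of_real pi) *
     (LINT \<phi>:{-pi..pi}|lebesgue. f (cis \<phi>) * cis (- (real_of_int n * \<phi>)))"

definition Hardy :: "(complex \<Rightarrow> complex) set \<Rightarrow> (complex \<Rightarrow> complex) set" where
  "Hardy X = {f \<in> X. \<forall>n<0. fourier_coeff f n = 0}"

definition analytic_polynomials :: "(complex \<Rightarrow> complex) set" where
  "analytic_polynomials = range poly"

end

theory Submission
  imports Defs "HOL-Probability.Probability"
begin

text \<open>Only boundedness of the exponent \<open>p\<close> matters, since it gives dominated convergence in the
  modular. Any \<open>f\<close> in the Hardy space lies in \<open>L\<^sup>1\<close>; multiplying it by the outer function of modulus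
  \<open>min 1 (n / \<bar>f\<bar>)\<close> gives a bounded function that is dominated by \<open>\<bar>f\<bar>\<close>, still has no negative Fourier
  coefficients, and tends to \<open>f\<close> almost everywhere along a subsequence. The Fejer means of a bounded
  analytic function are analytic polynomials, uniformly bounded and convergent to it in \<open>L\<^sup>1\<close>, hence
  almost everywhere along a subsequence. The outer functions are limits of \<open>exp (- P)\<close> with analytic
  polynomials \<open>P\<close> whose real parts approximate \<open>max 0 (ln (\<bar>f\<bar> / n))\<close> in \<open>L\<^sup>2\<close>; the identity
  \<open>\<integral> P\<^sup>2 = P(0)\<^sup>2\<close> bounds the imaginary parts.\<close>

subsection \<open>Integration on the circle\<close>

text \<open>Variable Lebesgue spaces are not translation invariant, so Fejer means of
  \<open>f\<close> itself have no evident uniform bound in the norm, and cutting \<open>f\<close>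
  off pointwise would destroy analyticity. No operator is therefore estimated on the space: each
  approximation has a majorant in the space (\<open>2 * f\<close> for the truncation, a constant for
  the Fejer means) and converges almost everywhere, the convergence coming from L1 and L2 estimates
  on the circle. The truncating factor must have a prescribed modulus, and its phase must also tend
  to that of 1. Logarithms in L2 serve both ends: \<open>(ln x)^2 <= 4 * x\<close> for
  \<open>x >= 1\<close> makes the positive part of the logarithm of an integrable function square
  integrable, and in L2 the conjugate function is controlled by an algebraic identity for
  polynomials. The approximating polynomials keep a nonnegative real part because the Fejer kernel
  is nonnegative, so \<open>exp (- P)\<close> stays bounded by 1 and dominated convergence
  applies.\<close>

abbreviation circle_borel :: "complex measure" where
  "circle_borel \<equiv> distr (uniform_measure lborel {-pi..pi}) (restrict_space borel (sphere 0 1)) cis"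

lemma measurable_cis [measurable]: "cis \<in> borel_measurable borel"
  by (intro borel_measurable_continuous_onI continuous_intros)

lemma measurable_cis_sphere:
  "cis \<in> measurable (uniform_measure lborel {-pi..pi}) (restrict_space borel (sphere 0 1))"
  by (intro measurable_restrict_space2) (auto simp: uniform_measure_def)

lemma prob_space_uniform: "prob_space (uniform_measure lborel {-pi..pi})"
  by (rule prob_space_uniform_measure) auto

interpretation circle: prob_space circle_measure
proof
  interpret U: prob_space "uniform_measure lborel {-pi..pi}" by (rule prob_space_uniform)
  interpret B: prob_space circle_borel by (rule U.prob_space_distr[OF measurable_cis_sphere])
  show "emeasure circle_measure (space circle_measure) = 1"
    unfolding circle_measure_def space_completion using B.emeasure_space_1 sets.top[of circle_borel]
    by (simp only: emeasure_completion main_part sets_completionI_sets)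
qed

lemma space_circle_measure: "space circle_measure = sphere 0 1"
  by (auto simp: circle_measure_def space_restrict_space)

lemma measurable_circle_measure:
  assumes "f \<in> borel_measurable borel"
  shows "f \<in> borel_measurable circle_measure"
  unfolding circle_measure_def
  by (rule measurable_completion) (auto intro!: measurable_restrict_space1 assms)

lemma id_measurable_circle [measurable]: "(\<lambda>t. t) \<in> borel_measurable circle_measure"
  by (rule measurable_circle_measure) auto

text \<open>The change of variables along \<open>cis\<close> is carried out for Borel functions,
  while \<open>circle_measure\<close> is a completion. Real and imaginary parts are replaced
  separately because the result on completions is applied to real functions.\<close>

lemma circle_ex_borel:
  fixes f :: "complex \<Rightarrow> complex"
  assumes f: "f \<in> borel_measurable circle_measure"
  obtains g where "g \<in> borel_measurable circle_borel" "AE t in circle_borel. f t = g t"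
proof -
  have "(\<lambda>t. Re (f t)) \<in> borel_measurable (completion circle_borel)"
    using f unfolding circle_measure_def by measurable
  then obtain a where a: "a \<in> borel_measurable circle_borel" "AE t in circle_borel. Re (f t) = a t"
    using completion_ex_borel_measurable_real by blast
  have "(\<lambda>t. Im (f t)) \<in> borel_measurable (completion circle_borel)"
    using f unfolding circle_measure_def by measurable
  then obtain b where b: "b \<in> borel_measurable circle_borel" "AE t in circle_borel. Im (f t) = b t"
    using completion_ex_borel_measurable_real by blast
  show ?thesis
  proof
    show "(\<lambda>t. Complex (a t) (b t)) \<in> borel_measurable circle_borel"
      unfolding Complex_eq using a(1) b(1) by measurable
    show "AE t in circle_borel. f t = Complex (a t) (b t)"
      using a(2) b(2) by eventually_elim (simp add: complex_eq_iff)
  qed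
qed

lemma uniform_measure_interval:
  "uniform_measure lborel {-pi..pi} = density lborel (\<lambda>x. ennreal (indicator {-pi..pi} x / (2*pi)))"
  unfolding uniform_measure_def
  by (intro density_cong) (auto simp: indicator_def divide_ennreal simp flip: ennreal_1)

lemma lebesgue_integral_circle:
  fixes f :: "complex \<Rightarrow> complex"
  assumes f: "f \<in> borel_measurable circle_measure"
  shows "(LINT \<phi>:{-pi..pi}|lebesgue. f (cis \<phi>)) = 2 * pi * (LINT t|circle_measure. f t)"
proof -
  obtain g where g: "g \<in> borel_measurable circle_borel" "AE t in circle_borel. f t = g t"
    using circle_ex_borel[OF f] .
  have g': "g \<in> borel_measurable (restrict_space borel (sphere 0 1))" using g(1) by simp
  have gU: "(\<lambda>x. g (cis x)) \<in> borel_measurable borel"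
    using measurable_compose[OF measurable_cis_sphere g'] by (simp add: uniform_measure_def)
  have "AE x in uniform_measure lborel {-pi..pi}. f (cis x) = g (cis x)"
    by (rule AE_distrD[OF measurable_cis_sphere g(2)])
  then have "AE x in lborel. x \<in> {-pi..pi} \<longrightarrow> f (cis x) = g (cis x)"
    by (subst (asm) AE_uniform_measure) auto
  then have "AE x in lborel. indicator {-pi..pi} x *\<^sub>R g (cis x) = indicator {-pi..pi} x *\<^sub>R f (cis x)"
    by eventually_elim (auto simp: indicator_def)
  then have ae: "AE x in lebesgue. indicator {-pi..pi} x *\<^sub>R g (cis x) = indicator {-pi..pi} x *\<^sub>R f (cis x)"
    by (rule AE_completion)
  have m: "(\<lambda>x. indicator {-pi..pi} x *\<^sub>R g (cis x)) \<in> borel_measurable lborel"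
    using gU by measurable
  have m1: "(\<lambda>x. indicator {-pi..pi} x *\<^sub>R g (cis x)) \<in> borel_measurable lebesgue"
    using measurable_completion[OF m] .
  \<comment> \<open>\<open>f\<close> is measurable only for the completed measure, so composing with
    \<open>cis\<close> does not give this directly; measurability is inherited from the
    representative \<open>g\<close> through almost everywhere equality.\<close>
  have m2: "(\<lambda>x. indicator {-pi..pi} x *\<^sub>R f (cis x)) \<in> borel_measurable lebesgue"
    by (rule borel_measurable_AE[OF m1 ae])
  have "(LINT \<phi>:{-pi..pi}|lebesgue. f (cis \<phi>)) = (LINT x|lebesgue. indicator {-pi..pi} x *\<^sub>R g (cis x))"
    unfolding set_lebesgue_integral_def
    by (rule integral_cong_AE[OF m2 m1]) (use ae in eventually_elim, auto)
  also have "\<dots> = (LINT x|lborel. indicator {-pi..pi} x *\<^sub>R g (cis x))"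
    by (rule integral_completion[OF m])
  also have "\<dots> = 2 * pi * (LINT x|lborel. (indicator {-pi..pi} x / (2*pi)) *\<^sub>R g (cis x))"
    by (subst integral_mult_right_zero[symmetric]) (simp add: scaleR_conv_of_real)
  also have "(LINT x|lborel. (indicator {-pi..pi} x / (2*pi)) *\<^sub>R g (cis x))
     = (LINT x|uniform_measure lborel {-pi..pi}. g (cis x))"
    unfolding uniform_measure_interval using gU by (subst integral_density) auto
  also have "\<dots> = (LINT t|circle_borel. g t)"
    by (rule integral_distr[OF measurable_cis_sphere, symmetric]) fact
  also have "\<dots> = (LINT t|circle_measure. g t)"
    unfolding circle_measure_def by (rule integral_completion[OF g(1), symmetric])
  also have "\<dots> = (LINT t|circle_measure. f t)"
  proof (rule integral_cong_AE)
    show "g \<in> borel_measurable circle_measure"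
      unfolding circle_measure_def by (rule measurable_completion) fact
    show "AE t in circle_measure. g t = f t"
      unfolding circle_measure_def by (rule AE_completion) (use g(2) in eventually_elim, simp)
  qed fact
  finally show ?thesis .
qed

lemma circle_ae_norm: "AE t in circle_measure. norm t = 1"
  by (rule AE_I2) (simp add: space_circle_measure)

lemma fourier_coeff_circle:
  assumes f: "f \<in> borel_measurable circle_measure"
  shows "fourier_coeff f n = (LINT t|circle_measure. f t * t powi (-n))"
proof -
  have m: "(\<lambda>t. f t * t powi (-n)) \<in> borel_measurable circle_measure"
    using f by (cases "n \<le> 0") (auto simp: power_int_def)
  have "(LINT \<phi>:{-pi..pi}|lebesgue. f (cis \<phi>) * cis (- (real_of_int n * \<phi>)))
      = (LINT \<phi>:{-pi..pi}|lebesgue. f (cis \<phi>) * cis \<phi> powi (-n))"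
    by (simp add: cis_power_int)
  with lebesgue_integral_circle[OF m] show ?thesis
    by (simp add: fourier_coeff_def)
qed

lemma integral_power_int_circle:
  "(LINT t|circle_measure. t powi n) = (if n = 0 then 1 else 0)"
proof (cases "n = 0")
  case True
  then show ?thesis using circle.prob_space by simp
next
  case False
  have m: "(\<lambda>t::complex. t powi n) \<in> borel_measurable circle_measure"
    by (cases "n \<le> 0") (auto simp: power_int_def)
  have "((\<lambda>x. cis (real_of_int n * x)) has_integral
      (cis (n * pi) / (\<i> * n) - cis (n * (-pi)) / (\<i> * n))) {-pi..pi}"
  proof (rule fundamental_theorem_of_calculus)
    fix x assume "x \<in> {-pi..pi}"
    show "((\<lambda>x. cis (n * x) / (\<i> * n)) has_vector_derivative cis (n * x)) (at x within {-pi..pi})"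
      using False unfolding cis_conv_exp
      by (auto intro!: derivative_eq_intros has_vector_derivative_real_field simp: field_simps scaleR_conv_of_real)
  qed auto
  moreover have "cis (n * pi) = cis (n * (-pi))"
    by (simp add: cis.ctr complex_eq_iff sin_zero_iff_int2)
  ultimately have hi: "((\<lambda>x. cis (real_of_int n * x)) has_integral 0) {-pi..pi}" by simp
  have "(LINT \<phi>:{-pi..pi}|lebesgue. cis \<phi> powi n) = (LINT \<phi>:{-pi..pi}|lborel. cis (real_of_int n * \<phi>))"
    unfolding set_lebesgue_integral_def cis_power_int by (subst integral_completion) auto
  also have "\<dots> = integral {-pi..pi} (\<lambda>x. cis (real_of_int n * x))"
    by (rule set_borel_integral_eq_integral(2))
       (auto intro!: borel_integrable_atLeastAtMost' continuous_intros)
  also have "\<dots> = 0" using hi by (rule integral_unique)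
  finally show ?thesis using lebesgue_integral_circle[OF m] False by simp
qed

subsection \<open>Density of trigonometric polynomials\<close>

lemma integrable_circle_mult:
  fixes f g :: "complex \<Rightarrow> complex"
  assumes f: "integrable circle_measure f" and g: "g \<in> borel_measurable circle_measure"
    and b: "\<And>t. t \<in> sphere 0 1 \<Longrightarrow> norm (g t) \<le> B"
  shows "integrable circle_measure (\<lambda>t. f t * g t)"
proof (rule Bochner_Integration.integrable_bound)
  show "integrable circle_measure (\<lambda>t. norm (f t) * B)" using f by auto
  show "(\<lambda>t. f t * g t) \<in> borel_measurable circle_measure"
    using f g by (auto intro: borel_measurable_times borel_measurable_integrable)
  show "AE t in circle_measure. norm (f t * g t) \<le> norm (norm (f t) * B)"
  proof (rule AE_I2)
    fix t assume t: "t \<in> space circle_measure"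
    then have "norm (g t) \<le> B" using b by (simp add: space_circle_measure)
    then have "norm (f t) * norm (g t) \<le> norm (f t) * \<bar>B\<bar>" by (intro mult_left_mono) auto
    then show "norm (f t * g t) \<le> norm (norm (f t) * B)" by (simp add: norm_mult abs_mult)
  qed
qed

lemma measurable_power_int_circle [measurable]:
  "(\<lambda>t::complex. t powi n) \<in> borel_measurable circle_measure"
  by (cases "n \<le> 0") (auto simp: power_int_def)

lemma norm_power_int_circle: "t \<in> sphere 0 1 \<Longrightarrow> norm ((t::complex) powi n) = 1"
  by (simp add: norm_power_int)

lemma integrable_circle_mult_power_int:
  assumes "integrable circle_measure f"
  shows "integrable circle_measure (\<lambda>t. f t * t powi n)"
  by (rule integrable_circle_mult[OF assms, where B = 1]) (auto simp: norm_power_int)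

lemma integrable_circle_bounded:
  fixes f :: "complex \<Rightarrow> 'b::{banach,second_countable_topology}"
  assumes "f \<in> borel_measurable circle_measure" "\<And>t. t \<in> sphere 0 1 \<Longrightarrow> norm (f t) \<le> B"
  shows "integrable circle_measure f"
  by (rule circle.integrable_const_bound[of _ B]) (auto simp: assms space_circle_measure)

text \<open>Every clause constrains its function on the circle only. This admits \<open>Re\<close>
  and \<open>Im\<close>, which agree with Laurent polynomials there because
  \<open>cnj t = inverse t\<close>, but nowhere else in general.\<close>

inductive trig_poly :: "(complex \<Rightarrow> complex) \<Rightarrow> bool" where
  monom: "(\<And>t. t \<in> sphere 0 1 \<Longrightarrow> f t = c * t powi n) \<Longrightarrow> trig_poly f"
| add: "trig_poly f \<Longrightarrow> trig_poly g \<Longrightarrow> (\<And>t. t \<in> sphere 0 1 \<Longrightarrow> h t = f t + g t) \<Longrightarrow> trig_poly h"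

lemma trig_poly_monom: "trig_poly (\<lambda>t. c * t powi n)"
  by (rule trig_poly.monom) (rule refl)

lemma trig_poly_mult_monom:
  assumes "trig_poly f" shows "trig_poly (\<lambda>t. c * t powi n * f t)"
  using assms
proof induction
  case (monom f d m)
  show ?case
  proof (rule trig_poly.monom)
    fix t :: complex assume t: "t \<in> sphere 0 1"
    then have "t \<noteq> 0" by auto
    then show "c * t powi n * f t = (c * d) * t powi (n + m)"
      using monom[OF t] by (simp add: power_int_add)
  qed
next
  case (add f g h)
  show ?case by (rule trig_poly.add[OF add.IH]) (auto simp: add.hyps algebra_simps)
qed

lemma trig_poly_mult:
  assumes "trig_poly f" "trig_poly g" shows "trig_poly (\<lambda>t. f t * g t)"
  using assms(1)
proof induction
  case (monom f c n)
  \<comment> \<open>Adding the zero monomial transfers \<open>trig_poly\<close> along an equality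
    that is known only on the circle.\<close>
  show ?case
    by (rule trig_poly.add[OF trig_poly_mult_monom[OF assms(2), of c n] trig_poly.monom[of "\<lambda>t. 0" 0 0]])
       (auto simp: monom)
next
  case (add f f' h)
  show ?case by (rule trig_poly.add[OF add.IH]) (auto simp: add.hyps algebra_simps)
qed

lemma trig_poly_const: "trig_poly (\<lambda>t. c)"
  by (rule trig_poly.monom[of _ c 0]) auto

lemma trig_poly_mult_const: "trig_poly f \<Longrightarrow> trig_poly (\<lambda>t. f t * c)"
  by (rule trig_poly_mult[OF _ trig_poly_const])

lemma trig_poly_add: "trig_poly f \<Longrightarrow> trig_poly g \<Longrightarrow> trig_poly (\<lambda>t. f t + g t)"
  by (rule trig_poly.add) auto

lemma sphere_cnj: "t \<in> sphere 0 1 \<Longrightarrow> cnj t = inverse (t::complex)"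
  by (simp add: inverse_complex_def complex_norm complex_eq_iff cmod_def)

lemma trig_poly_Re: "trig_poly (\<lambda>t. of_real (Re t))"
proof (rule trig_poly.add)
  show "trig_poly (\<lambda>t. 1/2 * t powi 1)" by (rule trig_poly_monom)
  show "trig_poly (\<lambda>t. 1/2 * t powi (-1))" by (rule trig_poly_monom)
  fix t :: complex assume "t \<in> sphere 0 1"
  then show "of_real (Re t) = 1 / 2 * t powi 1 + 1 / 2 * t powi - 1"
    using sphere_cnj[of t] by (simp add: complex_eq_iff power_int_minus)
qed

lemma trig_poly_Im: "trig_poly (\<lambda>t. of_real (Im t))"
proof (rule trig_poly.add)
  show "trig_poly (\<lambda>t. (-\<i>/2) * t powi 1)" by (rule trig_poly_monom)
  show "trig_poly (\<lambda>t. (\<i>/2) * t powi (-1))" by (rule trig_poly_monom)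
  fix t :: complex assume "t \<in> sphere 0 1"
  then show "of_real (Im t) = -\<i> / 2 * t powi 1 + \<i> / 2 * t powi - 1"
    using sphere_cnj[of t] by (simp add: complex_eq_iff power_int_minus)
qed

text \<open>The bridge to Stone-Weierstrass, whose approximants are polynomials in the real
  coordinates: a real-linear functional on the plane is a combination of \<open>Re\<close> and
  \<open>Im\<close>.\<close>

lemma trig_poly_real_polynomial:
  assumes "real_polynomial_function g" shows "trig_poly (\<lambda>t. of_real (g t))"
  using assms
proof induction
  case (linear f)
  have eq: "f t = Re t * f 1 + Im t * f \<i>" for t
  proof -
    interpret bounded_linear f by fact
    have "t = Re t *\<^sub>R 1 + Im t *\<^sub>R \<i>" by (simp add: complex_eq_iff)
    then have "f t = f (Re t *\<^sub>R 1 + Im t *\<^sub>R \<i>)" by (rule arg_cong)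
    then show ?thesis by (simp only: add scaleR) simp
  qed
  have "(\<lambda>t. of_real (f t)) = (\<lambda>t. of_real (Re t) * of_real (f 1) + of_real (Im t) * (of_real (f \<i>) :: complex))"
    by (rule ext) (simp only: of_real_mult[symmetric] of_real_add[symmetric] eq[symmetric])
  then show ?case
    by (simp only:) (intro trig_poly_add trig_poly_mult_const trig_poly_Re trig_poly_Im)
next
  case (const c)
  show ?case by (rule trig_poly_const)
next
  case (add f g)
  then show ?case by (simp add: trig_poly_add)
next
  case (mult f g)
  then show ?case by (simp add: trig_poly_mult)
qed

lemma trig_poly_integrable:
  assumes "trig_poly f" shows "integrable circle_measure f"
  using assms
proof induction
  case (monom f c n)
  have "integrable circle_measure (\<lambda>t. c * t powi n)"
    by (rule integrable_circle_bounded[where B = "norm c"]) (auto simp: norm_mult norm_power_int)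
  then show ?case
    by (subst Bochner_Integration.integrable_cong[OF refl, of _ _ "\<lambda>t. c * t powi n"])
       (auto simp: space_circle_measure monom)
next
  case (add f g h)
  have "integrable circle_measure (\<lambda>t. f t + g t)" using add.IH by auto
  then show ?case
    by (subst Bochner_Integration.integrable_cong[OF refl, of _ _ "\<lambda>t. f t + g t"])
       (auto simp: space_circle_measure add.hyps)
qed

text \<open>Regularity encloses the set between a compact \<open>K\<close> and an open
  \<open>U\<close> of nearly equal measure; a Urysohn function for this pair differs from the
  indicator at most by the indicator of \<open>U - K\<close>.\<close>

lemma circle_indicator_approx:
  assumes A: "A \<in> sets circle_measure" and e: "e > 0"
  obtains h :: "complex \<Rightarrow> real" where "continuous_on UNIV h"
    "(LINT t|circle_measure. \<bar>indicator A t - h t\<bar>) < e"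
proof -
  from A obtain S N N' where S: "A = S \<union> N" "N \<subseteq> N'" "N' \<in> null_sets circle_borel" "S \<in> sets circle_borel"
    unfolding circle_measure_def by (elim sets_completionE)
  have Sb: "S \<in> sets borel"
    using S(4) by (simp add: sets_restrict_space_iff)
  have "AE t in circle_measure. t \<notin> N'"
    unfolding circle_measure_def by (intro AE_completion AE_not_in S)
  then have ae: "AE t in circle_measure. indicator A t = (indicator S t :: real)"
    by eventually_elim (use S in \<open>auto simp: indicator_def\<close>)
  \<comment> \<open>Regularity applies to finite Borel measures on the whole plane, so the circle
    measure is pushed forward along the inclusion.\<close>
  define M where "M = distr circle_measure borel (\<lambda>t. t)"
  interpret M: prob_space M unfolding M_def by (rule circle.prob_space_distr) simp
  have sM: "sets M = sets borel" by (simp add: M_def)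
  have *: "emeasure M (space M) \<noteq> \<infinity>" by (simp add: M.emeasure_space_1)
  have "\<exists>K. K \<subseteq> S \<and> compact K \<and> measure M S - e/2 < measure M K"
  proof (rule ccontr)
    assume "\<not> ?thesis"
    then have le: "measure M K \<le> measure M S - e/2" if "K \<subseteq> S" "compact K" for K
      using that by force
    have "emeasure M S \<le> ennreal (measure M S - e/2)"
      unfolding inner_regular[OF sM * Sb]
      by (intro SUP_least) (auto simp: M.emeasure_eq_measure intro!: ennreal_leI le)
    \<comment> \<open>The empty set yields \<open>measure M S - e/2 >= 0\<close>; otherwise
      \<open>ennreal\<close> would collapse a negative number to 0 and there would be no
      contradiction.\<close>
    with le[of "{}"] e show False by (simp add: M.emeasure_eq_measure)
  qed
  then obtain K where K: "K \<subseteq> S" "compact K" "measure M S - e/2 < measure M K" by blast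
  have "\<exists>U. S \<subseteq> U \<and> open U \<and> measure M U < measure M S + e/2"
  proof (rule ccontr)
    assume "\<not> ?thesis"
    then have le: "measure M S + e/2 \<le> measure M U" if "S \<subseteq> U" "open U" for U
      using that by force
    have "ennreal (measure M S + e/2) \<le> emeasure M S"
      unfolding outer_regular[OF sM * Sb]
      by (intro INF_greatest) (auto simp: M.emeasure_eq_measure intro!: ennreal_leI le)
    then have "measure M S + e/2 \<le> measure M S"
      by (simp add: M.emeasure_eq_measure)
    with e show False by simp
  qed
  then obtain U where U: "S \<subseteq> U" "open U" "measure M U < measure M S + e/2" by blast
  obtain h :: "complex \<Rightarrow> real" where h: "continuous_on UNIV h" "\<And>x. h x \<in> closed_segment 1 0"
    "\<And>x. x \<in> K \<Longrightarrow> h x = 1" "\<And>x. x \<in> - U \<Longrightarrow> h x = 0"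
    by (rule Urysohn[of K "-U" 1 0]) (use K U in \<open>auto intro: compact_imp_closed\<close>)
  have hm[measurable]: "h \<in> borel_measurable borel" using h(1) by (rule borel_measurable_continuous_onI)
  have [measurable]: "S \<in> sets borel" "K \<in> sets borel" "U \<in> sets borel"
    using Sb K U by (auto intro: borel_compact)
  have h01: "0 \<le> h x" "h x \<le> 1" for x using h(2)[of x] by (auto simp: closed_segment_eq_real_ivl)
  have "(LINT t|circle_measure. \<bar>indicator A t - h t\<bar>) = (LINT t|circle_measure. \<bar>indicator S t - h t\<bar>)"
    by (rule integral_cong_AE) (use ae A in \<open>auto elim!: eventually_mono simp: measurable_circle_measure\<close>)
  also have "\<dots> = (LINT t|M. \<bar>indicator S t - h t\<bar>)"
    unfolding M_def by (subst integral_distr) auto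
  also have "\<dots> \<le> (LINT t|M. indicator U t - indicator K t)"
  proof (rule integral_mono)
    show "integrable M (\<lambda>t. \<bar>indicator S t - h t\<bar>)"
      by (rule M.integrable_const_bound[of _ 1]) (use h01 in \<open>auto simp: sM indicator_def M_def intro!: AE_I2\<close>)
    show "integrable M (\<lambda>t. indicator U t - indicator K t :: real)"
      by (rule M.integrable_const_bound[of _ 1]) (use h01 in \<open>auto simp: sM indicator_def M_def intro!: AE_I2\<close>)
    show "\<bar>indicator S t - h t\<bar> \<le> indicator U t - indicator K t" for t
      using h01[of t] h(3,4)[of t] K(1) U(1) by (auto simp: indicator_def)
  qed
  also have "\<dots> = measure M U - measure M K"
  proof -
    have "integrable M (indicator U :: complex \<Rightarrow> real)" "integrable M (indicator K :: complex \<Rightarrow> real)"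
      by (auto intro!: integrable_real_indicator simp: sM M.emeasure_eq_measure)
    then show ?thesis
      by (subst Bochner_Integration.integral_diff) (auto simp: M_def)
  qed
  also have "\<dots> < e"
    using K(3) U(3) e by simp
  finally show ?thesis using that h(1) by blast
qed

lemma trig_poly_dense_L1:
  assumes f: "integrable circle_measure f" and "e > 0"
  shows "\<exists>h. trig_poly h \<and> (LINT t|circle_measure. norm (f t - h t)) < e"
  using assms
proof (induction arbitrary: e)
  case (base A c)
  \<comment> \<open>\<open>d\<close> serves twice, as the L1 error of the continuous
    \<open>h\<close> and as the uniform error of the polynomial \<open>g\<close>. The summand 1
    keeps the quotient meaningful for \<open>c = 0\<close>.\<close>
  define d where "d = (e / 2) / (norm c + 1)"
  have d: "d > 0" using base by (simp add: d_def add_nonneg_pos)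
  have "norm c + 1 > 0" by (simp add: add_nonneg_pos)
  then have "(norm c + 1) * d = e / 2"
    using nonzero_mult_div_cancel_left[of "norm c + 1" "e / 2"] by (simp only: d_def times_divide_eq_right)
  with d have dc: "norm c * d < e / 2" by (simp add: distrib_right)
  obtain h where h: "continuous_on UNIV h" "(LINT t|circle_measure. \<bar>indicator A t - h t\<bar>) < d"
    using circle_indicator_approx[OF base(1) d] .
  obtain g where g: "real_polynomial_function g" "\<And>x. x \<in> sphere 0 1 \<Longrightarrow> \<bar>h x - g x\<bar> < d"
    by (rule Stone_Weierstrass_real_polynomial_function[of "sphere 0 1 :: complex set" h d])
       (use h d in \<open>auto intro: continuous_on_subset\<close>)
  have tg: "trig_poly (\<lambda>t. of_real (g t) * c)"
    by (rule trig_poly_mult_const[OF trig_poly_real_polynomial[OF g(1)]])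
  have gi: "integrable circle_measure g"
    using trig_poly_integrable[OF trig_poly_real_polynomial[OF g(1)]] by (simp add: complex_of_real_integrable_eq)
  have hm: "h \<in> borel_measurable circle_measure"
    by (rule measurable_circle_measure[OF borel_measurable_continuous_onI[OF h(1)]])
  obtain B where B: "\<And>t. t \<in> sphere 0 1 \<Longrightarrow> norm (h t) \<le> B"
    using compact_imp_bounded[OF compact_continuous_image[OF continuous_on_subset[OF h(1) subset_UNIV] compact_sphere[of 0 1]]]
    unfolding bounded_iff by blast
  have hi: "integrable circle_measure h" using hm B by (rule integrable_circle_bounded)
  have Ai: "integrable circle_measure (indicator A :: complex \<Rightarrow> real)"
    using base by (auto simp: less_top[symmetric])
  have "(LINT t|circle_measure. norm (indicator A t *\<^sub>R c - of_real (g t) * c))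
     \<le> (LINT t|circle_measure. norm c * \<bar>indicator A t - h t\<bar> + norm c * d)"
  proof (rule integral_mono)
    show "integrable circle_measure (\<lambda>t. norm (indicator A t *\<^sub>R c - of_real (g t) * c))"
      using Ai trig_poly_integrable[OF tg] by auto
    show "integrable circle_measure (\<lambda>t. norm c * \<bar>indicator A t - h t\<bar> + norm c * d)"
      using Ai hi by auto
    fix t assume t: "t \<in> space circle_measure"
    have "norm (indicator A t *\<^sub>R c - of_real (g t) * c) = norm c * \<bar>indicator A t - g t\<bar>"
    proof -
      have "indicator A t *\<^sub>R c - of_real (g t) * c = of_real (indicator A t - g t) * c"
        by (simp add: scaleR_conv_of_real left_diff_distrib)
      then show ?thesis by (simp add: norm_mult del: of_real_diff)
    qed
    also have "\<dots> \<le> norm c * (\<bar>indicator A t - h t\<bar> + d)"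
      using g(2)[of t] t by (intro mult_left_mono) (auto simp: space_circle_measure)
    finally show "norm (indicator A t *\<^sub>R c - of_real (g t) * c) \<le> norm c * \<bar>indicator A t - h t\<bar> + norm c * d"
      by (simp add: algebra_simps)
  qed
  also have "\<dots> = norm c * (LINT t|circle_measure. \<bar>indicator A t - h t\<bar>) + norm c * d"
    using Ai hi circle.prob_space by (subst Bochner_Integration.integral_add) auto
  also have "\<dots> \<le> norm c * d + norm c * d"
    using h(2) by (intro add_right_mono mult_left_mono) auto
  also have "\<dots> < e" using dc by linarith
  finally show ?case using tg by blast
next
  case (add f g)
  obtain a where a: "trig_poly a" "(LINT t|circle_measure. norm (f t - a t)) < e/2"
    using add.IH(1)[of "e/2"] add.prems by auto
  obtain b where b: "trig_poly b" "(LINT t|circle_measure. norm (g t - b t)) < e/2"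
    using add.IH(2)[of "e/2"] add.prems by auto
  have i: "integrable circle_measure a" "integrable circle_measure b"
    using a b by (auto intro: trig_poly_integrable)
  have "(LINT t|circle_measure. norm (f t + g t - (a t + b t)))
      \<le> (LINT t|circle_measure. norm (f t - a t) + norm (g t - b t))"
    using add.hyps i by (intro integral_mono) (auto intro: order_trans[OF norm_diff_triangle_ineq])
  also have "\<dots> < e" using a b add.hyps i by (subst Bochner_Integration.integral_add) auto
  finally show ?case using trig_poly_add[OF a(1) b(1)] by blast
next
  case (lim f s)
  have "(\<lambda>i. LINT t|circle_measure. norm (f t - s i t)) \<longlonglongrightarrow> (LINT t|circle_measure. norm (f t - f t))"
  \<comment> \<open>The induction principle for integrable functions supplies simple
    \<open>s i\<close> with \<open>norm (s i t) <= 2 * norm (f t)\<close>, hence the factor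
    3.\<close>
  proof (rule integral_dominated_convergence[where w = "\<lambda>t. 3 * norm (f t)"])
    show "AE t in circle_measure. (\<lambda>i. norm (f t - s i t)) \<longlonglongrightarrow> norm (f t - f t)"
      by (intro AE_I2 tendsto_intros lim.hyps)
    show "AE t in circle_measure. norm (norm (f t - s i t)) \<le> 3 * norm (f t)" for i
    proof (rule AE_I2)
      fix t assume "t \<in> space circle_measure"
      then have "norm (s i t) \<le> 2 * norm (f t)" by (rule lim.hyps)
      then show "norm (norm (f t - s i t)) \<le> 3 * norm (f t)"
        using norm_triangle_ineq4[of "f t" "s i t"] by simp
    qed
  qed (use lim.hyps in auto)
  then have "\<forall>\<^sub>F i in sequentially. (LINT t|circle_measure. norm (f t - s i t)) < e/2"
    using lim.prems by (intro order_tendstoD(2)) auto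
  then obtain i where i: "(LINT t|circle_measure. norm (f t - s i t)) < e/2"
    by (auto dest: eventually_happens)
  obtain a where a: "trig_poly a" "(LINT t|circle_measure. norm (s i t - a t)) < e/2"
    using lim.IH[of "e/2" i] lim.prems by auto
  have ai: "integrable circle_measure a" using a by (auto intro: trig_poly_integrable)
  have "(LINT t|circle_measure. norm (f t - a t))
      \<le> (LINT t|circle_measure. norm (f t - s i t) + norm (s i t - a t))"
  proof (rule integral_mono)
    show "norm (f t - a t) \<le> norm (f t - s i t) + norm (s i t - a t)" for t
      using norm_triangle_ineq[of "f t - s i t" "s i t - a t"] by simp
  qed (use lim.hyps ai in auto)
  also have "\<dots> < e" using a i lim.hyps ai by (subst Bochner_Integration.integral_add) auto
  finally show ?case using a(1) by blast
qed

subsection \<open>Fejer means\<close>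

text \<open>Grouping the pairs by \<open>n = i - j\<close> gives the usual weights
  \<open>(k - |n|) / k\<close>. The ungrouped double sum makes the kernel a squared modulus divided
  by \<open>k\<close>, so that its sign is visible.\<close>

definition fejer :: "nat \<Rightarrow> (complex \<Rightarrow> complex) \<Rightarrow> complex \<Rightarrow> complex" where
  "fejer k f t = (\<Sum>i<k. \<Sum>j<k. fourier_coeff f (int i - int j) * t powi (int i - int j)) / of_nat k"

definition fejer_kernel :: "nat \<Rightarrow> complex \<Rightarrow> real" where
  "fejer_kernel k z = (norm (\<Sum>j<k. z ^ j))\<^sup>2 / k"

lemma fourier_coeff_integrable:
  "integrable circle_measure f \<Longrightarrow> fourier_coeff f n = (LINT t|circle_measure. f t * t powi (-n))"
  by (rule fourier_coeff_circle) auto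

lemma fourier_coeff_cong:
  assumes "integrable circle_measure f" "\<And>t. t \<in> sphere 0 1 \<Longrightarrow> f t = g t"
  shows "fourier_coeff f n = fourier_coeff g n"
proof -
  have "integrable circle_measure g"
    using assms by (subst Bochner_Integration.integrable_cong[OF refl, of _ _ f]) (auto simp: space_circle_measure)
  moreover have "(LINT t|circle_measure. f t * t powi (-n)) = (LINT t|circle_measure. g t * t powi (-n))"
    by (rule Bochner_Integration.integral_cong) (auto simp: space_circle_measure assms)
  ultimately show ?thesis using assms(1) by (simp only: fourier_coeff_integrable)
qed

lemma fourier_coeff_add:
  assumes "integrable circle_measure f" "integrable circle_measure g"
  shows "fourier_coeff (\<lambda>t. f t + g t) n = fourier_coeff f n + fourier_coeff g n"
  using assms integrable_circle_mult_power_int[of _ "-n"]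
  by (simp add: fourier_coeff_integrable distrib_right)

lemma fourier_coeff_diff:
  assumes "integrable circle_measure f" "integrable circle_measure g"
  shows "fourier_coeff (\<lambda>t. f t - g t) n = fourier_coeff f n - fourier_coeff g n"
  using assms integrable_circle_mult_power_int[of _ "-n"]
  by (simp add: fourier_coeff_integrable left_diff_distrib)

lemma fourier_coeff_power_int:
  "fourier_coeff (\<lambda>t. c * t powi m) n = (if n = m then c else 0)"
proof -
  have "integrable circle_measure (\<lambda>t. c * t powi m)"
    by (rule trig_poly_integrable[OF trig_poly_monom])
  then have "fourier_coeff (\<lambda>t. c * t powi m) n = (LINT t|circle_measure. c * t powi m * t powi (-n))"
    by (rule fourier_coeff_integrable)
  also have "\<dots> = (LINT t|circle_measure. c * t powi (m - n))"
  proof (rule Bochner_Integration.integral_cong[OF refl])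
    fix t :: complex assume "t \<in> space circle_measure"
    then have "t \<noteq> 0" by (auto simp: space_circle_measure)
    then show "c * t powi m * t powi (-n) = c * t powi (m - n)"
      using power_int_add[of t m "-n"] by simp
  qed
  finally show ?thesis by (simp add: integral_power_int_circle)
qed

lemma fejer_diff:
  assumes "integrable circle_measure f" "integrable circle_measure g"
  shows "fejer k (\<lambda>t. f t - g t) t = fejer k f t - fejer k g t"
  using assms by (simp add: fejer_def fourier_coeff_diff left_diff_distrib sum_subtractf diff_divide_distrib)

lemma fejer_add:
  assumes "integrable circle_measure f" "integrable circle_measure g"
  shows "fejer k (\<lambda>t. f t + g t) t = fejer k f t + fejer k g t"
  using assms by (simp add: fejer_def fourier_coeff_add distrib_right sum.distrib add_divide_distrib)

lemma measurable_fejer [measurable]: "fejer k f \<in> borel_measurable circle_measure"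
  unfolding fejer_def by measurable

text \<open>A crude bound that depends on \<open>k\<close>; it serves integrability of the Fejer
  means.\<close>

lemma norm_fejer_le_sum:
  "t \<in> sphere 0 1 \<Longrightarrow> norm (fejer k f t) \<le> (\<Sum>i<k. \<Sum>j<k. norm (fourier_coeff f (int i - int j))) / k"
  unfolding fejer_def norm_divide
  by (auto intro!: divide_right_mono order_trans[OF norm_sum] sum_mono simp: norm_mult norm_power_int_circle)

lemma integrable_fejer: "integrable circle_measure (fejer k f)"
  by (rule integrable_circle_bounded[OF measurable_fejer norm_fejer_le_sum])

lemma fejer_kernel_eq:
  assumes "z \<in> sphere 0 1"
  shows "of_real (fejer_kernel k z) = (\<Sum>i<k. \<Sum>j<k. z powi (int i - int j)) / of_nat k"
proof -
  have z: "z \<noteq> 0" "cnj z = inverse z" using assms sphere_cnj[of z] by auto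
  have "of_real ((norm (\<Sum>j<k. z ^ j))\<^sup>2) = (\<Sum>j<k. z ^ j) * cnj (\<Sum>j<k. z ^ j)"
    by (rule complex_norm_square)
  also have "\<dots> = (\<Sum>i<k. \<Sum>j<k. z ^ i * inverse z ^ j)"
    by (simp add: sum_product z)
  also have "\<dots> = (\<Sum>i<k. \<Sum>j<k. z powi (int i - int j))"
    using z by (simp add: power_int_diff field_simps)
  finally show ?thesis by (simp add: fejer_kernel_def)
qed

text \<open>The convolution form, through which the sign of the kernel enters the estimates below.
  Integrability is recorded with it because those estimates compare integrals of the same
  integrand.\<close>

lemma fejer_eq_integral:
  assumes f: "integrable circle_measure f" and t: "t \<in> sphere 0 1"
  shows "fejer k f t = (LINT s|circle_measure. f s * of_real (fejer_kernel k (t / s)))"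
    and "integrable circle_measure (\<lambda>s. f s * of_real (fejer_kernel k (t / s)))"
proof -
  have eq: "f s * of_real (fejer_kernel k (t / s))
      = (\<Sum>i<k. \<Sum>j<k. (f s * s powi (-(int i - int j))) * t powi (int i - int j)) / of_nat k"
    if "s \<in> space circle_measure" for s
  proof -
    have s: "t / s \<in> sphere 0 1" "s \<noteq> 0" using that t by (auto simp: space_circle_measure norm_divide)
    have "(t / s) powi m = s powi (-m) * t powi m" for m
      by (simp add: power_int_divide_distrib power_int_minus field_simps)
    then show ?thesis
      unfolding fejer_kernel_eq[OF s(1)] by (simp add: sum_distrib_left mult.assoc)
  qed
  have i: "integrable circle_measure (\<lambda>s. f s * s powi m)" for m
    by (rule integrable_circle_mult_power_int[OF f])
  have i': "integrable circle_measure (\<lambda>s. f s * s powi (-m) * c)" for m c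
    using i[of "-m"] by (rule Bochner_Integration.integrable_mult_left)
  show "integrable circle_measure (\<lambda>s. f s * of_real (fejer_kernel k (t / s)))"
    by (subst Bochner_Integration.integrable_cong[OF refl eq])
       (assumption, intro Bochner_Integration.integrable_sum i' Bochner_Integration.integrable_divide)
  have "(LINT s|circle_measure. f s * of_real (fejer_kernel k (t / s)))
    = (LINT s|circle_measure. (\<Sum>i<k. \<Sum>j<k. (f s * s powi (-(int i - int j))) * t powi (int i - int j)) / of_nat k)"
    by (rule Bochner_Integration.integral_cong[OF refl eq])
  also have "\<dots> = (\<Sum>i<k. \<Sum>j<k. (LINT s|circle_measure. f s * s powi (-(int i - int j))) * t powi (int i - int j)) / of_nat k"
    by (simp only: integral_divide_zero integral_mult_left_zero Bochner_Integration.integral_sum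
          Bochner_Integration.integrable_sum i')
  also have "\<dots> = fejer k f t" by (simp only: fejer_def fourier_coeff_integrable[OF f])
  finally show "fejer k f t = (LINT s|circle_measure. f s * of_real (fejer_kernel k (t / s)))" ..
qed

lemma fejer_kernel_nonneg: "fejer_kernel k z \<ge> 0"
  by (simp add: fejer_kernel_def)

lemma norm_fejer_le:
  assumes f: "integrable circle_measure f" and t: "t \<in> sphere 0 1"
  shows "norm (fejer k f t) \<le> Re (fejer k (\<lambda>s. of_real (norm (f s))) t)"
proof -
  have f': "integrable circle_measure (\<lambda>s. complex_of_real (norm (f s)))" using f by auto
  have "norm (fejer k f t) \<le> (LINT s|circle_measure. norm (f s * of_real (fejer_kernel k (t / s))))"
    unfolding fejer_eq_integral(1)[OF f t] by (rule integral_norm_bound)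
  also have "\<dots> = (LINT s|circle_measure. Re (of_real (norm (f s)) * of_real (fejer_kernel k (t / s))))"
    by (simp add: norm_mult fejer_kernel_nonneg)
  also have "\<dots> = Re (fejer k (\<lambda>s. of_real (norm (f s))) t)"
    unfolding fejer_eq_integral(1)[OF f' t] by (rule integral_Re[OF fejer_eq_integral(2)[OF f' t]])
  finally show ?thesis .
qed

lemma fejer_monom:
  fixes t :: complex
  assumes f: "\<And>t. t \<in> sphere 0 1 \<Longrightarrow> f t = c * t powi n" and k: "nat \<bar>n\<bar> \<le> k"
  shows "fejer k f t = of_real ((real k - \<bar>n\<bar>) / k) * (c * t powi n)"
proof -
  have "integrable circle_measure f"
    by (rule trig_poly_integrable[OF trig_poly.monom[OF f]])
  then have fc: "fourier_coeff f m = (if m = n then c else 0)" for m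
    using fourier_coeff_cong[OF _ f] by (simp add: fourier_coeff_power_int)
  \<comment> \<open>For fixed \<open>i\<close> only \<open>j = i - n\<close> contributes. Both
    indices lie in \<open>0..<k\<close> exactly when \<open>max n 0 <= i < k + min n 0\<close>,
    which leaves \<open>k - |n|\<close> values of \<open>i\<close>.\<close>
  have "(\<Sum>j<k. fourier_coeff f (int i - int j) * t powi (int i - int j))
     = (if i \<in> {nat n ..< nat (int k + min n 0)} then c * t powi n else 0)" if "i < k" for i
  proof -
    have "(\<Sum>j<k. fourier_coeff f (int i - int j) * t powi (int i - int j))
        = (\<Sum>j<k. if j = nat (int i - n) \<and> n \<le> int i then c * t powi n else 0)"
      by (rule sum.cong) (auto simp: fc)
    also have "\<dots> = (if nat (int i - n) < k \<and> n \<le> int i then c * t powi n else 0)"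
      by (cases "n \<le> int i") auto
    also have "(nat (int i - n) < k \<and> n \<le> int i) = (i \<in> {nat n ..< nat (int k + min n 0)})"
      using that by auto
    finally show ?thesis .
  qed
  then have "fejer k f t = (\<Sum>i<k. if i \<in> {nat n ..< nat (int k + min n 0)} then c * t powi n else 0) / of_nat k"
    by (simp add: fejer_def)
  also have "\<dots> = (\<Sum>i\<in>{nat n ..< nat (int k + min n 0)}. c * t powi n) / of_nat k"
  proof -
    have "{..<k} \<inter> {nat n ..< nat (int k + min n 0)} = {nat n ..< nat (int k + min n 0)}" by auto
    then show ?thesis by (subst sum.inter_restrict[symmetric]) simp_all
  qed
  also have "\<dots> = of_real ((real k - \<bar>n\<bar>) / k) * (c * t powi n)"
  proof -
    have "real (nat (int k + min n 0) - nat n) = real k - \<bar>n\<bar>" using k by (auto simp: min_def)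
    then have "of_nat (nat (int k + min n 0) - nat n) = complex_of_real (real k - \<bar>n\<bar>)"
      by (metis of_real_of_nat_eq)
    then show ?thesis by simp
  qed
  finally show ?thesis .
qed

text \<open>The kernel is nonnegative with mean 1; the mean is read off by applying
  \<open>fejer_monom\<close> to the constant \<open>B\<close>. An almost everywhere bound becomes a
  bound at every point of the circle since \<open>f\<close> enters through an integral.\<close>

lemma norm_fejer_bound:
  assumes f: "f \<in> borel_measurable circle_measure" and B: "AE t in circle_measure. norm (f t) \<le> B"
    and k: "k > 0" and t: "t \<in> sphere 0 1"
  shows "norm (fejer k f t) \<le> B"
proof -
  have fi: "integrable circle_measure f" by (rule circle.integrable_const_bound[OF B f])
  have Bi: "integrable circle_measure (\<lambda>t. complex_of_real B)" by simp
  have "norm (fejer k f t) \<le> (LINT s|circle_measure. norm (f s * of_real (fejer_kernel k (t / s))))"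
    unfolding fejer_eq_integral(1)[OF fi t] by (rule integral_norm_bound)
  also have "\<dots> \<le> (LINT s|circle_measure. Re (of_real B * of_real (fejer_kernel k (t / s))))"
  proof (rule integral_mono_AE)
    show "integrable circle_measure (\<lambda>s. norm (f s * of_real (fejer_kernel k (t / s))))"
      using fejer_eq_integral(2)[OF fi t] by auto
    show "integrable circle_measure (\<lambda>s. Re (of_real B * of_real (fejer_kernel k (t / s))))"
      using fejer_eq_integral(2)[OF Bi t] by (rule integrable_Re)
    show "AE s in circle_measure. norm (f s * of_real (fejer_kernel k (t / s)))
        \<le> Re (of_real B * of_real (fejer_kernel k (t / s)))"
      using B by eventually_elim (auto simp: norm_mult fejer_kernel_nonneg intro!: mult_right_mono)
  qed
  also have "\<dots> = Re (fejer k (\<lambda>t. of_real B) t)"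
    unfolding fejer_eq_integral(1)[OF Bi t] by (rule integral_Re[OF fejer_eq_integral(2)[OF Bi t]])
  also have "\<dots> = B"
    using k by (subst fejer_monom[where n = 0 and c = "of_real B"]) auto
  finally show ?thesis .
qed

text \<open>This keeps the real parts of the approximating polynomials nonnegative, so that
  \<open>exp (- P)\<close> has modulus at most 1.\<close>

lemma Re_fejer_nonneg:
  assumes f: "integrable circle_measure f" and f0: "AE t in circle_measure. 0 \<le> f t" and t: "t \<in> sphere 0 1"
  shows "0 \<le> Re (fejer k (\<lambda>t. of_real (f t)) t)"
proof -
  have f': "integrable circle_measure (\<lambda>t. complex_of_real (f t))" using f by auto
  have eq: "fejer k (\<lambda>t. of_real (f t)) t = of_real (LINT s|circle_measure. f s * fejer_kernel k (t / s))"
    unfolding fejer_eq_integral(1)[OF f' t] by (simp flip: of_real_mult)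
  have "0 \<le> (LINT s|circle_measure. f s * fejer_kernel k (t / s))"
    by (rule integral_nonneg_AE) (use f0 in eventually_elim, simp add: fejer_kernel_nonneg)
  then show ?thesis using eq by simp
qed

lemma integral_fejer:
  assumes "k > 0" shows "(LINT t|circle_measure. fejer k f t) = fourier_coeff f 0"
proof -
  have i: "integrable circle_measure (\<lambda>t. c * t powi n)" for c n
    by (rule trig_poly_integrable[OF trig_poly_monom])
  have "(LINT t|circle_measure. fejer k f t)
    = (\<Sum>i<k. \<Sum>j<k. fourier_coeff f (int i - int j) * (LINT t|circle_measure. t powi (int i - int j))) / of_nat k"
    unfolding fejer_def
    by (simp only: integral_divide_zero integral_mult_right_zero Bochner_Integration.integral_sum
          Bochner_Integration.integrable_sum i)
  also have "\<dots> = (\<Sum>i<k. \<Sum>j<k. if j = i then fourier_coeff f 0 else 0) / of_nat k"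
    by (intro arg_cong2[where f="(/)"] sum.cong refl) (auto simp: integral_power_int_circle)
  also have "\<dots> = fourier_coeff f 0" using assms by simp
  finally show ?thesis .
qed

text \<open>Integrating the pointwise bound \<open>norm_fejer_le\<close> and evaluating the zeroth
  coefficient of \<open>norm f\<close> takes the place of Fubini and Young's convolution
  inequality.\<close>

lemma fejer_L1_contraction:
  assumes f: "integrable circle_measure f" and k: "k > 0"
  shows "(LINT t|circle_measure. norm (fejer k f t)) \<le> (LINT t|circle_measure. norm (f t))"
proof -
  have f': "integrable circle_measure (\<lambda>s. complex_of_real (norm (f s)))" using f by auto
  have "(LINT t|circle_measure. norm (fejer k f t))
     \<le> (LINT t|circle_measure. Re (fejer k (\<lambda>s. of_real (norm (f s))) t))"
    by (rule integral_mono) (auto intro!: integrable_norm integrable_Re integrable_fejer norm_fejer_le[OF f] simp: space_circle_measure)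
  also have "\<dots> = Re (fourier_coeff (\<lambda>s. of_real (norm (f s))) 0)"
    by (simp add: integral_Re[OF integrable_fejer] integral_fejer[OF k])
  also have "\<dots> = (LINT t|circle_measure. norm (f t))"
    by (simp add: fourier_coeff_integrable[OF f'])
  finally show ?thesis .
qed

lemma fejer_trig_poly:
  assumes "trig_poly h"
  shows "(\<lambda>k. LINT t|circle_measure. norm (fejer k h t - h t)) \<longlonglongrightarrow> 0"
  using assms
proof induction
  case (monom f c n)
  have eq: "(LINT t|circle_measure. norm (fejer k f t - f t)) = norm c * (\<bar>n\<bar> / k)" if "k > nat \<bar>n\<bar>" for k
  proof -
    have "(LINT t|circle_measure. norm (fejer k f t - f t)) = (LINT t|circle_measure. norm c * (\<bar>n\<bar> / k))"
    proof (rule Bochner_Integration.integral_cong[OF refl])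
      fix t assume t: "t \<in> space circle_measure"
      have "fejer k f t - f t = of_real ((real k - \<bar>n\<bar>) / k) * (c * t powi n) - c * t powi n"
        using t that by (subst fejer_monom[OF monom]) (auto simp: space_circle_measure monom)
      also have "\<dots> = - of_real (\<bar>n\<bar> / k) * (c * t powi n)"
        using that by (simp add: field_simps)
      finally show "norm (fejer k f t - f t) = norm c * (\<bar>n\<bar> / k)"
        using t by (simp add: norm_mult norm_divide norm_power_int space_circle_measure)
    qed
    then show ?thesis using circle.prob_space by simp
  qed
  have ev: "\<forall>\<^sub>F k in sequentially. norm c * (\<bar>n\<bar> / k) = (LINT t|circle_measure. norm (fejer k f t - f t))"
    using eventually_gt_at_top[of "nat \<bar>n\<bar>"] by eventually_elim (rule eq[symmetric])
  have "(\<lambda>k. norm c * (\<bar>n\<bar> / real k)) \<longlonglongrightarrow> norm c * 0"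
    by (intro tendsto_intros lim_const_over_n)
  with ev show ?case using tendsto_cong[OF ev] by simp
next
  case (add f g h)
  have fi: "integrable circle_measure f" and gi: "integrable circle_measure g"
    using add.hyps by (auto intro: trig_poly_integrable)
  have hi: "integrable circle_measure h"
    by (rule trig_poly_integrable[OF trig_poly.add[OF add.hyps]])
  have "fejer k h = fejer k (\<lambda>t. f t + g t)" for k
    unfolding fejer_def fourier_coeff_cong[OF hi add.hyps(3), simplified] ..
  then have fh: "fejer k h t = fejer k f t + fejer k g t" for k t
    using fi gi by (simp add: fejer_add)
  have le: "(LINT t|circle_measure. norm (fejer k h t - h t))
     \<le> (LINT t|circle_measure. norm (fejer k f t - f t)) + (LINT t|circle_measure. norm (fejer k g t - g t))" for k
  proof -
    have "(LINT t|circle_measure. norm (fejer k h t - h t))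
     \<le> (LINT t|circle_measure. norm (fejer k f t - f t) + norm (fejer k g t - g t))"
      using fi gi hi integrable_fejer
      by (intro integral_mono)
         (auto simp: fh add.hyps space_circle_measure intro: order_trans[OF norm_diff_triangle_ineq])
    also have "\<dots> = (LINT t|circle_measure. norm (fejer k f t - f t)) + (LINT t|circle_measure. norm (fejer k g t - g t))"
      using fi gi integrable_fejer by (intro Bochner_Integration.integral_add) auto
    finally show ?thesis .
  qed
  show ?case
    by (rule tendsto_sandwich[OF _ _ tendsto_const tendsto_add_zero[OF add.IH]])
       (auto intro!: always_eventually le)
qed

text \<open>The contraction property bounds the error uniformly in \<open>k\<close>, so density
  reduces the claim to trigonometric polynomials.\<close>

lemma fejer_L1_tendsto:
  assumes f: "integrable circle_measure f"
  shows "(\<lambda>k. LINT t|circle_measure. norm (fejer k f t - f t)) \<longlonglongrightarrow> 0"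
proof (rule LIMSEQ_I)
  fix r :: real assume r: "r > 0"
  then obtain h where h: "trig_poly h" "(LINT t|circle_measure. norm (f t - h t)) < r/3"
    using trig_poly_dense_L1[OF f, of "r/3"] by auto
  have hi: "integrable circle_measure h" using h(1) by (rule trig_poly_integrable)
  have d: "integrable circle_measure (\<lambda>t. f t - h t)" using f hi by auto
  have "\<forall>\<^sub>F k in sequentially. (LINT t|circle_measure. norm (fejer k h t - h t)) < r/3"
    using fejer_trig_poly[OF h(1)] r by (intro order_tendstoD(2)) auto
  with eventually_gt_at_top[of 0]
  have "\<forall>\<^sub>F k in sequentially. norm ((LINT t|circle_measure. norm (fejer k f t - f t)) - 0) < r"
  proof eventually_elim
    case (elim k)
    have "(LINT t|circle_measure. norm (fejer k f t - f t))
       \<le> (LINT t|circle_measure. norm (fejer k (\<lambda>t. f t - h t) t) + norm (fejer k h t - h t) + norm (f t - h t))"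
    proof (rule integral_mono)
      fix t
      have eq: "fejer k f t - f t = fejer k (\<lambda>t. f t - h t) t + (fejer k h t - h t) - (f t - h t)"
        using fejer_diff[OF f hi, of k t] by simp
      show "norm (fejer k f t - f t) \<le> norm (fejer k (\<lambda>t. f t - h t) t) + norm (fejer k h t - h t) + norm (f t - h t)"
        unfolding eq
        using norm_triangle_ineq4[of "fejer k (\<lambda>t. f t - h t) t + (fejer k h t - h t)" "f t - h t"]
          norm_triangle_ineq[of "fejer k (\<lambda>t. f t - h t) t" "fejer k h t - h t"] by linarith
    qed (use f hi d integrable_fejer in auto)
    also have "\<dots> = (LINT t|circle_measure. norm (fejer k (\<lambda>t. f t - h t) t))
        + (LINT t|circle_measure. norm (fejer k h t - h t)) + (LINT t|circle_measure. norm (f t - h t))"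
      using f hi d integrable_fejer by (simp add: Bochner_Integration.integral_add)
    also have "\<dots> < r"
      using fejer_L1_contraction[OF d elim(1)] h(2) elim(2) by simp
    finally show ?case by simp
  qed
  then show "\<exists>no. \<forall>n\<ge>no. norm ((LINT t|circle_measure. norm (fejer n f t - f t)) - 0) < r"
    by (simp add: eventually_sequentially)
qed

subsection \<open>Analytic polynomials with prescribed real part\<close>

lemma fejer_analytic:
  assumes "\<And>n. n < 0 \<Longrightarrow> fourier_coeff f n = 0"
  obtains q where "\<And>t. fejer k f t = poly q t"
proof
  fix t :: complex
  define q where "q = smult (1 / of_nat k) (\<Sum>i<k. \<Sum>j<k. if j \<le> i then monom (fourier_coeff f (int i - int j)) (i - j) else 0)"
  have "fourier_coeff f (int i - int j) * t powi (int i - int j)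
      = poly (if j \<le> i then monom (fourier_coeff f (int i - int j)) (i - j) else 0) t" for i j
    using assms[of "int i - int j"] by (auto simp: poly_monom simp flip: of_nat_diff)
  then show "fejer k f t = poly q t"
    unfolding fejer_def q_def by (simp add: poly_sum)
qed

lemma fourier_coeff_uminus:
  assumes "integrable circle_measure f"
  shows "fourier_coeff (\<lambda>t. of_real (f t)) (-n) = cnj (fourier_coeff (\<lambda>t. of_real (f t)) n)"
proof -
  have i: "integrable circle_measure (\<lambda>t. complex_of_real (f t))" using assms by auto
  have "(LINT t|circle_measure. of_real (f t) * t powi n)
      = (LINT t|circle_measure. cnj (of_real (f t) * t powi (-n)))"
    by (rule Bochner_Integration.integral_cong)
       (auto simp: space_circle_measure sphere_cnj power_int_minus power_int_inverse)
  also have "\<dots> = cnj (LINT t|circle_measure. of_real (f t) * t powi (-n))"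
    by (rule Bochner_Integration.integral_cnj)
  finally show ?thesis
    by (simp only: fourier_coeff_integrable[OF i] minus_minus)
qed

text \<open>For real \<open>u\<close> the terms of index \<open>m\<close> and \<open>-m\<close> are
  conjugate on the circle. Folding negative frequencies onto positive ones thus leaves the real part
  unchanged and completes the Fejer mean to an analytic polynomial with real constant term.\<close>

lemma fejer_real_eq_Re_poly:
  assumes u: "integrable circle_measure u"
  obtains P where "\<And>t. t \<in> sphere 0 1 \<Longrightarrow> Re (poly P t) = Re (fejer k (\<lambda>t. of_real (u t)) t)"
    "Im (poly P 0) = 0"
proof
  let ?c = "fourier_coeff (\<lambda>t. of_real (u t))"
  define P where "P = smult (of_real (1 / k)) (\<Sum>i<k. \<Sum>j<k. monom (?c \<bar>int i - int j\<bar>) (nat \<bar>int i - int j\<bar>))"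
  have "?c 0 = cnj (?c 0)" using fourier_coeff_uminus[OF u, of 0] by simp
  then have c0: "Im (?c 0) = 0" by (simp add: complex_eq_iff)
  have "poly P 0 = of_real (1/k) * (\<Sum>i<k. \<Sum>j<k. if i = j then ?c 0 else 0)"
  proof -
    have "?c \<bar>int i - int j\<bar> * 0 ^ nat \<bar>int i - int j\<bar> = (if i = j then ?c 0 else 0)" for i j
      by auto
    then show ?thesis unfolding P_def by (simp only: poly_smult poly_sum poly_monom)
  qed
  then show "Im (poly P 0) = 0" using c0 by simp
  fix t :: complex assume t: "t \<in> sphere 0 1"
  have "Re (?c \<bar>m\<bar> * t ^ nat \<bar>m\<bar>) = Re (?c m * t powi m)" for m
  proof (cases "m \<ge> 0")
    case True
    then show ?thesis by (simp add: power_int_def)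
  next
    case False
    then have "?c m * t powi m = cnj (?c (-m) * t powi (-m))"
      using fourier_coeff_uminus[OF u, of "-m"] sphere_cnj[OF t] by (simp add: power_int_minus power_int_inverse)
    also have "Re \<dots> = Re (?c (-m) * t powi (-m))" by (rule cnj.sel)
    finally show ?thesis using False by (simp add: power_int_def)
  qed
  then show "Re (poly P t) = Re (fejer k (\<lambda>t. of_real (u t)) t)"
    unfolding P_def fejer_def by (simp add: poly_sum poly_monom Re_divide_of_nat)
qed

lemma measurable_poly_circle [measurable]: "poly q \<in> borel_measurable circle_measure"
  by (intro measurable_circle_measure borel_measurable_continuous_onI continuous_intros)

lemma bounded_poly_sphere:
  fixes q :: "complex poly"
  obtains B where "\<And>t. t \<in> sphere 0 1 \<Longrightarrow> norm (poly q t) \<le> B"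
proof -
  have "bounded (poly q ` sphere 0 1)"
    by (intro compact_imp_bounded compact_continuous_image continuous_intros compact_sphere)
  then show ?thesis using that unfolding bounded_iff by blast
qed

lemma integrable_poly_circle: "integrable circle_measure (poly q)"
  by (rule bounded_poly_sphere[of q]) (rule integrable_circle_bounded[OF measurable_poly_circle])

lemma integral_poly_circle: "(LINT t|circle_measure. poly q t) = poly q 0"
proof -
  have i: "integrable circle_measure (\<lambda>t. c * t ^ n)" for c :: complex and n
    using trig_poly_integrable[OF trig_poly_monom, of c "int n"] by simp
  have "(LINT t|circle_measure. poly q t) = (\<Sum>i\<le>degree q. coeff q i * (LINT t|circle_measure. t ^ i))"
    unfolding poly_altdef
    by (simp only: integral_mult_right_zero Bochner_Integration.integral_sum i)
  also have "\<dots> = (\<Sum>i\<le>degree q. if i = 0 then coeff q i else 0)"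
    using integral_power_int_circle[of "int i" for i] by (intro sum.cong) auto
  also have "\<dots> = poly q 0" by (simp add: poly_0_coeff_0)
  finally show ?thesis .
qed

lemma integrable_poly_sq:
  "integrable circle_measure (\<lambda>t. (norm (poly q t))\<^sup>2)"
  "integrable circle_measure (\<lambda>t. (Re (poly q t))\<^sup>2)"
  "integrable circle_measure (\<lambda>t. (Im (poly q t))\<^sup>2)"
proof -
  obtain B where B: "\<And>t. t \<in> sphere 0 1 \<Longrightarrow> norm (poly q t) \<le> B" by (rule bounded_poly_sphere[of q]) blast
  have B2: "(norm (poly q t))\<^sup>2 \<le> B\<^sup>2" if "t \<in> sphere 0 1" for t
    using B[OF that] by (intro power_mono) auto
  have le: "(Re z)\<^sup>2 \<le> (norm z)\<^sup>2" "(Im z)\<^sup>2 \<le> (norm z)\<^sup>2" for z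
    by (simp_all add: cmod_power2)
  show "integrable circle_measure (\<lambda>t. (norm (poly q t))\<^sup>2)"
    by (rule integrable_circle_bounded[of _ "B\<^sup>2"]) (use B2 in auto)
  show "integrable circle_measure (\<lambda>t. (Re (poly q t))\<^sup>2)"
    by (rule integrable_circle_bounded[of _ "B\<^sup>2"])
       (use order_trans[OF le(1) B2] in auto)
  show "integrable circle_measure (\<lambda>t. (Im (poly q t))\<^sup>2)"
    by (rule integrable_circle_bounded[of _ "B\<^sup>2"])
       (use order_trans[OF le(2) B2] in auto)
qed

text \<open>The L2 bound for the conjugate function. The real part of \<open>P^2\<close> is
  \<open>(Re P)^2 - (Im P)^2\<close>, and its mean is the real part of \<open>P(0)^2\<close>, which
  is nonnegative because \<open>P(0)\<close> is real. Hence the imaginary part is no larger than the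
  real part in L2.\<close>

lemma poly_L2_le_Re:
  assumes "Im (poly P 0) = 0"
  shows "(LINT t|circle_measure. (norm (poly P t))\<^sup>2) \<le> 2 * (LINT t|circle_measure. (Re (poly P t))\<^sup>2)"
proof -
  have "(LINT t|circle_measure. (Re (poly P t))\<^sup>2) - (LINT t|circle_measure. (Im (poly P t))\<^sup>2)
      = (LINT t|circle_measure. Re (poly (P * P) t))"
    using integrable_poly_sq[of P]
    by (subst Bochner_Integration.integral_diff[symmetric]) (auto simp: power2_eq_square)
  also have "\<dots> = Re (poly (P * P) 0)"
    by (simp only: integral_Re[OF integrable_poly_circle] integral_poly_circle)
  also have "\<dots> \<ge> 0" using assms by simp
  finally have "(LINT t|circle_measure. (Im (poly P t))\<^sup>2) \<le> (LINT t|circle_measure. (Re (poly P t))\<^sup>2)" by simp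
  moreover have "(LINT t|circle_measure. (norm (poly P t))\<^sup>2)
      = (LINT t|circle_measure. (Re (poly P t))\<^sup>2) + (LINT t|circle_measure. (Im (poly P t))\<^sup>2)"
    using integrable_poly_sq[of P]
    by (subst Bochner_Integration.integral_add[symmetric]) (auto simp: cmod_power2)
  ultimately show ?thesis by simp
qed

text \<open>Nonnegativity of the variance. It converts L2 estimates into the L1 Cauchy property from
  which an almost everywhere convergent subsequence is extracted.\<close>

lemma (in prob_space) sq_integral_le:
  fixes X :: "'a \<Rightarrow> real"
  assumes "integrable M X" "integrable M (\<lambda>x. (X x)\<^sup>2)"
  shows "(LINT x|M. X x)\<^sup>2 \<le> (LINT x|M. (X x)\<^sup>2)"
  using variance_eq[OF assms] variance_positive[of X] by simp

lemma sum_sq_le: "((a::real) - c)\<^sup>2 \<le> 2 * (a - b)\<^sup>2 + 2 * (b - c)\<^sup>2"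
  using sum_squares_bound[of "a - b" "b - c"] by (simp add: power2_eq_square algebra_simps)

text \<open>Fejer convergence is at hand in L1, but L2 is wanted. Cutting \<open>u\<close> at level
  \<open>N\<close> keeps both the truncation \<open>v\<close> and \<open>Re P\<close> in
  \<open>[0, N]\<close>, so the squared error is at most \<open>N\<close> times the error.\<close>

lemma poly_Re_approx:
  fixes u :: "complex \<Rightarrow> real"
  assumes u[measurable]: "u \<in> borel_measurable circle_measure" and u0: "\<And>t. 0 \<le> u t"
    and u2: "integrable circle_measure (\<lambda>t. (u t)\<^sup>2)" and e: "e > 0"
  obtains P where "Im (poly P 0) = 0" "\<And>t. t \<in> sphere 0 1 \<Longrightarrow> 0 \<le> Re (poly P t)"
    "integrable circle_measure (\<lambda>t. (Re (poly P t) - u t)\<^sup>2)"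
    "(LINT t|circle_measure. (Re (poly P t) - u t)\<^sup>2) < e"
proof -
  have vd: "(min (u t) (real N) - u t)\<^sup>2 \<le> (u t)\<^sup>2" for t N
    using u0[of t] by (subst power2_commute, intro power_mono) auto
  have vi: "integrable circle_measure (\<lambda>t. (min (u t) (real N) - u t)\<^sup>2)" for N
    by (rule Bochner_Integration.integrable_bound[OF u2]) (use vd in auto)
  have "(\<lambda>N. LINT t|circle_measure. (min (u t) (real N) - u t)\<^sup>2) \<longlonglongrightarrow> (LINT t|circle_measure. 0)"
  proof (rule integral_dominated_convergence[where w = "\<lambda>t. (u t)\<^sup>2"])
    show "AE t in circle_measure. (\<lambda>N. (min (u t) (real N) - u t)\<^sup>2) \<longlonglongrightarrow> 0"
    proof (rule AE_I2)
      fix t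
      have "\<forall>\<^sub>F N in sequentially. (min (u t) (real N) - u t)\<^sup>2 = 0"
        using eventually_ge_at_top[of "nat \<lceil>u t\<rceil>"] by eventually_elim auto
      then show "(\<lambda>N. (min (u t) (real N) - u t)\<^sup>2) \<longlonglongrightarrow> 0" by (rule tendsto_eventually)
    qed
  qed (use u2 vd in auto)
  \<comment> \<open>\<open>sum_sq_le\<close> doubles both squared errors, so each may take
    \<open>e/4\<close>; the Fejer error is accordingly required to be below
    \<open>e / (4 * N)\<close>.\<close>
  then have "\<forall>\<^sub>F N in sequentially. (LINT t|circle_measure. (min (u t) (real N) - u t)\<^sup>2) < e/4"
    using e by (intro order_tendstoD(2)) auto
  from eventually_happens[OF eventually_conj[OF this eventually_gt_at_top[of 0]]]
  obtain N where N: "(LINT t|circle_measure. (min (u t) (real N) - u t)\<^sup>2) < e/4" "N > 0"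
    by auto
  define v where "v t = min (u t) (real N)" for t
  have vm[measurable]: "v \<in> borel_measurable circle_measure" unfolding v_def by measurable
  have v0: "0 \<le> v t" "v t \<le> real N" for t using u0[of t] by (auto simp: v_def)
  have vI: "integrable circle_measure v" by (rule integrable_circle_bounded[OF vm, of N]) (use v0 in auto)
  then have vI': "integrable circle_measure (\<lambda>t. complex_of_real (v t))" by auto
  have "\<forall>\<^sub>F k in sequentially. (LINT t|circle_measure. norm (fejer k (\<lambda>t. of_real (v t)) t - of_real (v t))) < e / (4 * N)"
    using fejer_L1_tendsto[OF vI'] e N(2) by (intro order_tendstoD(2)) auto
  from eventually_happens[OF eventually_conj[OF this eventually_gt_at_top[of 0]]]
  obtain k where k: "k > 0"
    "(LINT t|circle_measure. norm (fejer k (\<lambda>t. of_real (v t)) t - of_real (v t))) < e / (4 * N)"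
    by auto
  obtain P where P: "\<And>t. t \<in> sphere 0 1 \<Longrightarrow> Re (poly P t) = Re (fejer k (\<lambda>t. of_real (v t)) t)" "Im (poly P 0) = 0"
    by (rule fejer_real_eq_Re_poly[OF vI, of k]) blast
  have P0: "0 \<le> Re (poly P t)" if "t \<in> sphere 0 1" for t
    using Re_fejer_nonneg[OF vI _ that] v0 P(1)[OF that] by auto
  have PN: "Re (poly P t) \<le> N" if t: "t \<in> sphere 0 1" for t
  proof -
    have "norm (fejer k (\<lambda>t. of_real (v t)) t) \<le> N"
      by (rule norm_fejer_bound[OF _ _ k(1) t]) (use v0 in auto)
    then show ?thesis unfolding P(1)[OF t] using complex_Re_le_cmod order_trans by blast
  qed
  have le1: "(Re (poly P t) - v t)\<^sup>2 \<le> N * norm (fejer k (\<lambda>t. of_real (v t)) t - of_real (v t))"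
    if t: "t \<in> sphere 0 1" for t
  proof -
    have a: "\<bar>Re (poly P t) - v t\<bar> \<le> N" using P0[OF t] PN[OF t] v0[of t] by auto
    have b: "\<bar>Re (poly P t) - v t\<bar> \<le> norm (fejer k (\<lambda>t. of_real (v t)) t - of_real (v t))"
      using abs_Re_le_cmod[of "fejer k (\<lambda>t. of_real (v t)) t - of_real (v t)"] P(1)[OF t] by simp
    have "(Re (poly P t) - v t)\<^sup>2 = \<bar>Re (poly P t) - v t\<bar> * \<bar>Re (poly P t) - v t\<bar>"
      by (simp add: power2_eq_square)
    also have "\<dots> \<le> N * norm (fejer k (\<lambda>t. of_real (v t)) t - of_real (v t))"
      using a b by (intro mult_mono) auto
    finally show ?thesis .
  qed
  have i1: "integrable circle_measure (\<lambda>t. norm (fejer k (\<lambda>t. of_real (v t)) t - of_real (v t)))"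
    using integrable_fejer vI' by auto
  have le2: "(Re (poly P t) - u t)\<^sup>2 \<le> 2 * (N * norm (fejer k (\<lambda>t. of_real (v t)) t - of_real (v t)))
      + 2 * (min (u t) (real N) - u t)\<^sup>2" if t: "t \<in> sphere 0 1" for t
    using sum_sq_le[of "Re (poly P t)" "u t" "v t"] le1[OF t] by (simp add: v_def)
  let ?w = "\<lambda>t. 2 * (N * norm (fejer k (\<lambda>t. of_real (v t)) t - of_real (v t))) + 2 * (min (u t) (real N) - u t)\<^sup>2"
  have iw: "integrable circle_measure ?w" using i1 vi by auto
  have iP: "integrable circle_measure (\<lambda>t. (Re (poly P t) - u t)\<^sup>2)"
    by (rule Bochner_Integration.integrable_bound[OF iw])
       (use le2 in \<open>force simp: space_circle_measure intro!: AE_I2\<close>)+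
  have "(LINT t|circle_measure. (Re (poly P t) - u t)\<^sup>2) \<le> (LINT t|circle_measure. ?w t)"
    by (rule integral_mono[OF iP iw]) (use le2 in \<open>auto simp: space_circle_measure\<close>)
  also have "\<dots> = 2 * (N * (LINT t|circle_measure. norm (fejer k (\<lambda>t. of_real (v t)) t - of_real (v t))))
      + 2 * (LINT t|circle_measure. (min (u t) (real N) - u t)\<^sup>2)"
    using i1 vi by (subst Bochner_Integration.integral_add) auto
  also have "\<dots> < e"
  proof -
    have "N * (LINT t|circle_measure. norm (fejer k (\<lambda>t. of_real (v t)) t - of_real (v t))) < e/4"
      using k(2) N(2) by (simp add: field_simps)
    with N(1) show ?thesis by linarith
  qed
  finally show ?thesis using that[OF P(2) P0 iP] by simp
qed

text \<open>The derivative of \<open>exp\<close> is bounded by 1 on the half-plane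
  \<open>Re w <= 0\<close>, which is convex and contains both \<open>0\<close> and
  \<open>-z\<close>.\<close>

lemma norm_one_minus_exp_le:
  assumes "0 \<le> Re z" shows "norm (1 - exp (- z)) \<le> norm z"
proof -
  have "norm (exp (-z) - exp 0) \<le> 1 * norm (- z - 0)"
  proof (rule field_differentiable_bound[where f = exp and f' = exp and S = "{w. Re w \<le> 0}"])
    show "convex {w. Re w \<le> 0}" by (rule convex_halfspace_Re_le)
  qed (use assms in \<open>auto intro: DERIV_subset[OF DERIV_exp]\<close>)
  then show ?thesis by (simp add: norm_minus_commute)
qed

subsection \<open>Outer functions\<close>

text \<open>The limit \<open>\<phi>\<close> is the outer function with modulus \<open>exp (- u)\<close>: the polynomials \<open>P k\<close> converge
  in \<open>L\<^sup>2\<close> because their imaginary parts are controlled by their real parts.\<close>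

lemma outer_function_exists:
  fixes u :: "complex \<Rightarrow> real"
  assumes u[measurable]: "u \<in> borel_measurable circle_measure" and u0: "\<And>t. 0 \<le> u t"
    and u2: "integrable circle_measure (\<lambda>t. (u t)\<^sup>2)"
  obtains P \<phi> where "\<phi> \<in> borel_measurable circle_measure"
    "\<And>k t. t \<in> sphere 0 1 \<Longrightarrow> 0 \<le> Re (poly (P k) t)"
    "AE t in circle_measure. (\<lambda>k. exp (- poly (P k) t)) \<longlonglongrightarrow> \<phi> t"
    "AE t in circle_measure. norm (\<phi> t) = exp (- u t)"
    "(LINT t|circle_measure. (norm (1 - \<phi> t))\<^sup>2) \<le> 4 * (LINT t|circle_measure. (u t)\<^sup>2)"
proof -
  define e where "e k = inverse (real (Suc k))" for k
  have e0: "e k > 0" for k by (simp add: e_def)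
  have elim: "e \<longlonglongrightarrow> 0" unfolding e_def by (rule LIMSEQ_inverse_real_of_nat)
  let ?approx = "\<lambda>P d. Im (poly P 0) = 0 \<and> (\<forall>t\<in>sphere 0 1. 0 \<le> Re (poly P t)) \<and>
    integrable circle_measure (\<lambda>t. (Re (poly P t) - u t)\<^sup>2) \<and>
    (LINT t|circle_measure. (Re (poly P t) - u t)\<^sup>2) < d"
  have "\<exists>P. ?approx P (e k)" for k
    by (rule poly_Re_approx[OF u u0 u2 e0[of k]]) blast
  then have "\<exists>Q. \<forall>k. ?approx (Q k) (e k)" by (intro choice allI)
  then obtain Q where "\<forall>k. ?approx (Q k) (e k)" ..
  then have Q: "\<And>k. Im (poly (Q k) 0) = 0" "\<And>k t. t \<in> sphere 0 1 \<Longrightarrow> 0 \<le> Re (poly (Q k) t)"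
    "\<And>k. integrable circle_measure (\<lambda>t. (Re (poly (Q k) t) - u t)\<^sup>2)"
    "\<And>k. (LINT t|circle_measure. (Re (poly (Q k) t) - u t)\<^sup>2) < e k"
    by blast+
  \<comment> \<open>The 4 is 2 from \<open>poly_L2_le_Re\<close> times 2 from
    \<open>sum_sq_le\<close>. The normalization of the constant terms passes to
    \<open>Q i - Q j\<close>, so the real parts control the whole difference.\<close>
  have diff_le: "(LINT t|circle_measure. norm (poly (Q i) t - poly (Q j) t))\<^sup>2 \<le> 4 * (e i + e j)" for i j
  proof -
    have "(LINT t|circle_measure. norm (poly (Q i) t - poly (Q j) t))\<^sup>2
        = (LINT t|circle_measure. norm (poly (Q i - Q j) t))\<^sup>2" by simp
    also have "\<dots> \<le> (LINT t|circle_measure. (norm (poly (Q i - Q j) t))\<^sup>2)"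
      by (intro circle.sq_integral_le integrable_norm integrable_poly_circle integrable_poly_sq)
    also have "\<dots> \<le> 2 * (LINT t|circle_measure. (Re (poly (Q i - Q j) t))\<^sup>2)"
      by (rule poly_L2_le_Re) (simp add: Q(1))
    also have "(LINT t|circle_measure. (Re (poly (Q i - Q j) t))\<^sup>2)
      \<le> (LINT t|circle_measure. 2 * (Re (poly (Q i) t) - u t)\<^sup>2 + 2 * (Re (poly (Q j) t) - u t)\<^sup>2)"
    proof (rule integral_mono)
      fix t
      show "(Re (poly (Q i - Q j) t))\<^sup>2 \<le> 2 * (Re (poly (Q i) t) - u t)\<^sup>2 + 2 * (Re (poly (Q j) t) - u t)\<^sup>2"
        using sum_sq_le[of "Re (poly (Q i) t)" "Re (poly (Q j) t)" "u t"]
        by (simp add: power2_commute[of "u t"])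
    qed (use Q(3) integrable_poly_sq(2)[of "Q i - Q j"] in auto)
    also have "\<dots> = 2 * (LINT t|circle_measure. (Re (poly (Q i) t) - u t)\<^sup>2)
        + 2 * (LINT t|circle_measure. (Re (poly (Q j) t) - u t)\<^sup>2)"
      using Q(3) by (subst Bochner_Integration.integral_add) auto
    finally show ?thesis using Q(4)[of i] Q(4)[of j] by simp
  qed
  have cauchy: "\<exists>N. \<forall>i\<ge>N. \<forall>j\<ge>N. (LINT t|circle_measure. norm (poly (Q i) t - poly (Q j) t)) < d"
    if d: "d > 0" for d
  proof -
    \<comment> \<open>With both errors below \<open>d^2 / 8\<close>, the bound
      \<open>4 * (e i + e j)\<close> falls below \<open>d^2\<close>.\<close>
    have "\<forall>\<^sub>F k in sequentially. e k < d\<^sup>2 / 8" using elim d by (intro order_tendstoD(2)) auto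
    then obtain N where N: "\<And>k. k \<ge> N \<Longrightarrow> e k < d\<^sup>2 / 8" by (auto simp: eventually_sequentially)
    have "(LINT t|circle_measure. norm (poly (Q i) t - poly (Q j) t)) < d" if "i \<ge> N" "j \<ge> N" for i j
    proof (rule power2_less_imp_less)
      show "(LINT t|circle_measure. norm (poly (Q i) t - poly (Q j) t))\<^sup>2 < d\<^sup>2"
      proof (rule le_less_trans[OF diff_le])
        show "4 * (e i + e j) < d\<^sup>2"
          using add_strict_mono[OF N[OF that(1)] N[OF that(2)]] by simp
      qed
    qed (use d in simp)
    then show ?thesis by blast
  qed
  \<comment> \<open>Two extractions are made: along \<open>r\<close> the polynomials themselves
    converge almost everywhere, which gives the limit a phase; along the further subsequence
    \<open>s\<close> their real parts converge to \<open>u\<close>, which fixes its modulus.\<close>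
  obtain r where r: "strict_mono r" "AE t in circle_measure. Cauchy (\<lambda>k. poly (Q (r k)) t)"
    by (rule cauchy_L1_AE_cauchy_subseq[of circle_measure "\<lambda>k. poly (Q k)"])
       (use integrable_poly_circle cauchy in auto)
  have Qr: "(LINT t|circle_measure. norm ((Re (poly (Q (r k)) t) - u t)\<^sup>2)) \<le> e (r k)" for k
    using Q(4)[of "r k"] by simp
  have "(\<lambda>k. LINT t|circle_measure. norm ((Re (poly (Q (r k)) t) - u t)\<^sup>2)) \<longlonglongrightarrow> 0"
    by (rule tendsto_sandwich[OF _ _ tendsto_const LIMSEQ_subseq_LIMSEQ[OF elim r(1)]])
       (use Qr in \<open>auto simp: o_def\<close>)
  with Q(3) obtain s where s: "strict_mono s"
    "AE t in circle_measure. (\<lambda>k. (Re (poly (Q (r (s k))) t) - u t)\<^sup>2) \<longlonglongrightarrow> 0"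
    using tendsto_L1_AE_subseq[of circle_measure "\<lambda>k t. (Re (poly (Q (r k)) t) - u t)\<^sup>2"] by blast
  define P where "P k = Q (r (s k))" for k
  \<comment> \<open>\<open>lim\<close> is total and has an unspecified value where the sequence
    diverges; this occurs only on a null set, by \<open>conv\<close>.\<close>
  define \<phi> where "\<phi> t = lim (\<lambda>k. exp (- poly (P k) t))" for t
  have Pm: "(\<lambda>t. exp (- poly (P k) t)) \<in> borel_measurable circle_measure" for k
    by (intro measurable_circle_measure borel_measurable_continuous_onI continuous_intros)
  have \<phi>m[measurable]: "\<phi> \<in> borel_measurable circle_measure"
    unfolding \<phi>_def using Pm by (rule borel_measurable_lim_metric)
  have conv: "AE t in circle_measure. (\<exists>l. (\<lambda>k. poly (P k) t) \<longlonglongrightarrow> l \<and> \<phi> t = exp (- l))"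
    using r(2)
  proof eventually_elim
    case (elim t)
    then obtain l where "(\<lambda>k. poly (Q (r k)) t) \<longlonglongrightarrow> l"
      by (auto simp: Cauchy_convergent_iff convergent_def)
    from LIMSEQ_subseq_LIMSEQ[OF this s(1)] have l: "(\<lambda>k. poly (P k) t) \<longlonglongrightarrow> l"
      by (simp add: P_def o_def)
    then have "(\<lambda>k. exp (- poly (P k) t)) \<longlonglongrightarrow> exp (- l)" by (intro tendsto_intros)
    then have "\<phi> t = exp (- l)" unfolding \<phi>_def by (rule limI)
    with l show ?case by blast
  qed
  have lim: "AE t in circle_measure. (\<lambda>k. exp (- poly (P k) t)) \<longlonglongrightarrow> \<phi> t"
    using conv by eventually_elim (auto intro!: tendsto_intros)
  have P0: "0 \<le> Re (poly (P k) t)" if "t \<in> sphere 0 1" for k t using Q(2)[OF that] by (simp add: P_def)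
  have exp1: "norm (exp (- poly (P k) t)) \<le> 1" if "t \<in> sphere 0 1" for k t
    using P0[OF that] by simp
  have mod: "AE t in circle_measure. norm (\<phi> t) = exp (- u t)"
    using conv s(2)
  proof eventually_elim
    case (elim t)
    then obtain l where l: "(\<lambda>k. poly (P k) t) \<longlonglongrightarrow> l" "\<phi> t = exp (- l)" by blast
    have "(\<lambda>k. (Re (poly (P k) t) - u t)\<^sup>2) \<longlonglongrightarrow> (Re l - u t)\<^sup>2" by (intro tendsto_intros l)
    moreover have "(\<lambda>k. (Re (poly (P k) t) - u t)\<^sup>2) \<longlonglongrightarrow> 0" using elim(2) by (simp add: P_def)
    ultimately have "(Re l - u t)\<^sup>2 = 0" by (rule LIMSEQ_unique)
    with l(2) show ?case by simp
  qed
  have le4: "(norm (1 - exp (- poly (P k) t)))\<^sup>2 \<le> 4" if "t \<in> sphere 0 1" for k t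
  proof -
    have "norm (1 - exp (- poly (P k) t)) \<le> 2"
      using norm_triangle_ineq4[of 1 "exp (- poly (P k) t)"] exp1[OF that, of k]
        norm_one[where 'a = complex] by linarith
    then have "(norm (1 - exp (- poly (P k) t)))\<^sup>2 \<le> 2\<^sup>2" by (intro power_mono) auto
    then show ?thesis by simp
  qed
  have "(\<lambda>k. LINT t|circle_measure. (norm (1 - exp (- poly (P k) t)))\<^sup>2)
      \<longlonglongrightarrow> (LINT t|circle_measure. (norm (1 - \<phi> t))\<^sup>2)"
  proof (rule integral_dominated_convergence[where w = "\<lambda>_. 4"])
    show "AE t in circle_measure. (\<lambda>k. (norm (1 - exp (- poly (P k) t)))\<^sup>2) \<longlonglongrightarrow> (norm (1 - \<phi> t))\<^sup>2"
      using lim by eventually_elim (intro tendsto_intros)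
    show "AE t in circle_measure. norm ((norm (1 - exp (- poly (P k) t)))\<^sup>2) \<le> 4" for k
      by (rule AE_I2) (use le4 in \<open>simp add: space_circle_measure\<close>)
    show "(\<lambda>t. (norm (1 - exp (- poly (P k) t)))\<^sup>2) \<in> borel_measurable circle_measure" for k
      using Pm[of k] by measurable
  qed auto
  moreover have "(\<lambda>k. 4 * e (r (s k)) + 4 * (LINT t|circle_measure. (u t)\<^sup>2))
      \<longlonglongrightarrow> 4 * 0 + 4 * (LINT t|circle_measure. (u t)\<^sup>2)"
    using LIMSEQ_subseq_LIMSEQ[OF LIMSEQ_subseq_LIMSEQ[OF elim r(1)] s(1)]
    by (intro tendsto_intros) (simp add: o_def)
  \<comment> \<open>The estimate passes from \<open>1 - exp (- P)\<close> to \<open>P\<close>, then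
    to \<open>Re P\<close>, then splits \<open>Re P\<close> as \<open>(Re P - u) + u\<close>. The
    first part contributes the error that vanishes in the limit.\<close>
  moreover have "(LINT t|circle_measure. (norm (1 - exp (- poly (P k) t)))\<^sup>2)
      \<le> 4 * e (r (s k)) + 4 * (LINT t|circle_measure. (u t)\<^sup>2)" for k
  proof -
    have "(LINT t|circle_measure. (norm (1 - exp (- poly (P k) t)))\<^sup>2) \<le> (LINT t|circle_measure. (norm (poly (P k) t))\<^sup>2)"
    proof (rule integral_mono)
      show "integrable circle_measure (\<lambda>t. (norm (1 - exp (- poly (P k) t)))\<^sup>2)"
        by (rule integrable_circle_bounded[where B=4]) (use le4 Pm[of k] in auto)
      show "(norm (1 - exp (- poly (P k) t)))\<^sup>2 \<le> (norm (poly (P k) t))\<^sup>2" if "t \<in> space circle_measure" for t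
        using that P0[of t k] by (intro power_mono norm_one_minus_exp_le) (auto simp: space_circle_measure)
    qed (rule integrable_poly_sq)
    also have "\<dots> \<le> 2 * (LINT t|circle_measure. (Re (poly (P k) t))\<^sup>2)"
      by (rule poly_L2_le_Re) (simp add: P_def Q(1))
    also have "(LINT t|circle_measure. (Re (poly (P k) t))\<^sup>2)
      \<le> (LINT t|circle_measure. 2 * (Re (poly (P k) t) - u t)\<^sup>2 + 2 * (u t)\<^sup>2)"
      using sum_sq_le[of "Re (poly (P k) t)" 0 "u t" for t]
      by (intro integral_mono) (use u2 Q(3) integrable_poly_sq in \<open>auto simp: P_def\<close>)
    also have "\<dots> = 2 * (LINT t|circle_measure. (Re (poly (P k) t) - u t)\<^sup>2) + 2 * (LINT t|circle_measure. (u t)\<^sup>2)"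
      using u2 Q(3) by (subst Bochner_Integration.integral_add) (auto simp: P_def)
    finally show ?thesis using Q(4)[of "r (s k)"] by (simp add: P_def)
  qed
  ultimately have "(LINT t|circle_measure. (norm (1 - \<phi> t))\<^sup>2) \<le> 4 * (LINT t|circle_measure. (u t)\<^sup>2)"
    by (auto intro: LIMSEQ_le)
  with that \<phi>m P0 lim mod show ?thesis by blast
qed

section \<open>Multipliers that preserve vanishing negative Fourier coefficients\<close>

text \<open>Dominated convergence with majorant \<open>B * norm f\<close>. It is used twice: from
  Taylor polynomials to the exponential, and from \<open>exp (- P k)\<close> to the outer
  function.\<close>

lemma fourier_coeff_mult_limit:
  assumes f: "integrable circle_measure f"
    and g: "\<And>k. g k \<in> borel_measurable circle_measure" "\<And>k t. t \<in> sphere 0 1 \<Longrightarrow> norm (g k t) \<le> B"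
    and h: "h \<in> borel_measurable circle_measure" "AE t in circle_measure. (\<lambda>k. g k t) \<longlonglongrightarrow> h t"
    and zero: "\<And>k. fourier_coeff (\<lambda>t. f t * g k t) n = 0"
  shows "integrable circle_measure (\<lambda>t. f t * h t)" "fourier_coeff (\<lambda>t. f t * h t) n = 0"
proof -
  have [measurable]: "f \<in> borel_measurable circle_measure" using f by auto
  note [measurable] = g(1) h(1)
  have le: "norm (f t * g k t * t powi m) \<le> B * norm (f t)" if "t \<in> sphere 0 1" for t k m
    using mult_left_mono[OF g(2)[OF that, of k], of "norm (f t)"] that
    by (simp add: norm_mult norm_power_int mult.commute)
  have B: "integrable circle_measure (\<lambda>t. B * norm (f t))" using f by auto
  have ilim: "integrable circle_measure (\<lambda>t. f t * h t * t powi m)"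
      "(\<lambda>k. LINT t|circle_measure. f t * g k t * t powi m) \<longlonglongrightarrow> (LINT t|circle_measure. f t * h t * t powi m)" for m
  proof -
    have ae: "AE t in circle_measure. (\<lambda>k. f t * g k t * t powi m) \<longlonglongrightarrow> f t * h t * t powi m"
      using h(2) by eventually_elim (intro tendsto_intros)
    have bd: "AE t in circle_measure. norm (f t * g k t * t powi m) \<le> B * norm (f t)" for k
      by (rule AE_I2) (use le in \<open>simp add: space_circle_measure\<close>)
    show "integrable circle_measure (\<lambda>t. f t * h t * t powi m)"
      by (rule integrable_dominated_convergence[OF _ _ B ae bd]) measurable
    show "(\<lambda>k. LINT t|circle_measure. f t * g k t * t powi m) \<longlonglongrightarrow> (LINT t|circle_measure. f t * h t * t powi m)"
      by (rule integral_dominated_convergence[OF _ _ B ae bd]) measurable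
  qed
  show "integrable circle_measure (\<lambda>t. f t * h t)" using ilim(1)[of 0] by simp
  have "(LINT t|circle_measure. f t * g k t * t powi (-n)) = 0" for k
    using zero[of k] by (subst (asm) fourier_coeff_circle) auto
  with ilim(2)[of "-n"] have "(LINT t|circle_measure. f t * h t * t powi (-n)) = 0"
    by (simp add: LIMSEQ_const_iff)
  then show "fourier_coeff (\<lambda>t. f t * h t) n = 0"
    by (subst fourier_coeff_circle) auto
qed

text \<open>Multiplication by \<open>t^i\<close> turns the coefficient of index \<open>n\<close>
  into that of index \<open>n - i\<close>, which is still negative.\<close>

lemma fourier_coeff_mult_poly:
  assumes f: "integrable circle_measure f" and neg: "\<And>n. n < 0 \<Longrightarrow> fourier_coeff f n = 0" and n: "n < 0"
  shows "fourier_coeff (\<lambda>t. f t * poly q t) n = 0"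
proof -
  have [measurable]: "f \<in> borel_measurable circle_measure" using f by auto
  have "fourier_coeff (\<lambda>t. f t * poly q t) n = (LINT t|circle_measure. f t * poly q t * t powi (-n))"
    by (rule fourier_coeff_circle) measurable
  also have "\<dots> = (LINT t|circle_measure. (\<Sum>i\<le>degree q. coeff q i * (f t * t powi (int i - n))))"
  proof (rule Bochner_Integration.integral_cong[OF refl])
    fix t :: complex assume "t \<in> space circle_measure"
    then have t: "t \<noteq> 0" by (auto simp: space_circle_measure)
    have "t powi (int i - n) = t ^ i * t powi (-n)" for i
      using t power_int_add[of t "int i" "-n"] by simp
    then show "f t * poly q t * t powi (-n) = (\<Sum>i\<le>degree q. coeff q i * (f t * t powi (int i - n)))"
      by (simp add: poly_altdef sum_distrib_left sum_distrib_right mult_ac)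
  qed
  also have "\<dots> = (\<Sum>i\<le>degree q. coeff q i * (LINT t|circle_measure. f t * t powi (int i - n)))"
    by (simp only: integral_mult_right_zero Bochner_Integration.integral_sum
       Bochner_Integration.integrable_mult_right integrable_circle_mult_power_int[OF f])
  also have "\<dots> = 0"
    using neg[of "n - int i" for i] n by (simp add: fourier_coeff_integrable[OF f])
  finally show ?thesis .
qed

lemma fourier_coeff_mult_exp_poly:
  assumes f: "integrable circle_measure f" and neg: "\<And>n. n < 0 \<Longrightarrow> fourier_coeff f n = 0" and n: "n < 0"
  shows "fourier_coeff (\<lambda>t. f t * exp (poly q t)) n = 0"
proof -
  obtain B where B: "\<And>t. t \<in> sphere 0 1 \<Longrightarrow> norm (poly q t) \<le> B" by (rule bounded_poly_sphere[of q]) blast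
  \<comment> \<open>The Taylor polynomials of \<open>exp\<close> composed with \<open>q\<close> are
    again analytic polynomials, bounded on the circle by \<open>exp B\<close> uniformly in
    \<open>k\<close>.\<close>
  define Q where "Q k = (\<Sum>j<k. smult (of_real (inverse (fact j))) (q ^ j))" for k
  have Q: "poly (Q k) t = (\<Sum>j<k. (poly q t) ^ j /\<^sub>R fact j)" for k t
    by (simp add: Q_def poly_sum scaleR_conv_of_real)
  show ?thesis
  proof (rule fourier_coeff_mult_limit(2)[OF f, of "\<lambda>k. poly (Q k)" "exp B"])
    fix k and t :: complex assume t: "t \<in> sphere 0 1"
    have "norm (poly (Q k) t) \<le> (\<Sum>j<k. norm (poly q t) ^ j /\<^sub>R fact j)"
      unfolding Q by (rule order_trans[OF norm_sum]) (simp add: norm_power)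
    also have "\<dots> \<le> exp (norm (poly q t))"
      using exp_converges[of "norm (poly q t)"]
      by (subst sums_unique[OF exp_converges[of "norm (poly q t)"]]) (auto intro!: sum_le_suminf dest: sums_summable)
    also have "\<dots> \<le> exp B" using B[OF t] by simp
    finally show "norm (poly (Q k) t) \<le> exp B" .
  next
    show "AE t in circle_measure. (\<lambda>k. poly (Q k) t) \<longlonglongrightarrow> exp (poly q t)"
      using exp_converges[of "poly q t" for t] unfolding Q sums_def by (intro AE_I2)
    show "(\<lambda>t. exp (poly q t)) \<in> borel_measurable circle_measure"
      by (intro measurable_circle_measure borel_measurable_continuous_onI continuous_intros)
  qed (use fourier_coeff_mult_poly[OF f neg n] in auto)
qed

section \<open>Truncation inside the Hardy class\<close>

text \<open>Writing \<open>ln x = 2 * ln (sqrt x)\<close> gains the square root that makes the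
  logarithms below square integrable when \<open>f\<close> is merely integrable.\<close>

lemma ln_sq_le:
  fixes x :: real
  assumes "x \<ge> 1" shows "(ln x)\<^sup>2 \<le> 4 * x"
proof -
  have "ln x = 2 * ln (sqrt x)" using assms by (simp add: ln_sqrt)
  also have "ln (sqrt x) \<le> sqrt x" using assms ln_le_minus_one[of "sqrt x"] by simp
  finally have "(ln x)\<^sup>2 \<le> (2 * sqrt x)\<^sup>2" using assms by (intro power_mono) auto
  then show ?thesis using assms by (simp add: power_mult_distrib)
qed

text \<open>The factors \<open>\<phi> n\<close> have modulus \<open>min 1 (Suc n / \<bar>f\<bar>)\<close>; multiplying by them truncates \<open>f\<close> without
  leaving the Hardy class.\<close>

lemma bounded_analytic_approx:
  assumes f: "integrable circle_measure f" and neg: "\<And>n. n < 0 \<Longrightarrow> fourier_coeff f n = 0"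
  obtains g where "\<And>k. g k \<in> borel_measurable circle_measure"
    "\<And>k n. n < 0 \<Longrightarrow> fourier_coeff (g k) n = 0"
    "\<And>k. AE t in circle_measure. norm (g k t) \<le> norm (f t)"
    "\<And>k. \<exists>B. AE t in circle_measure. norm (g k t) \<le> B"
    "AE t in circle_measure. (\<lambda>k. g k t) \<longlonglongrightarrow> f t"
proof -
  have fm[measurable]: "f \<in> borel_measurable circle_measure" using f by auto
  \<comment> \<open>\<open>exp (- u n t)\<close> is the wanted modulus. Taking \<open>max 1\<close>
    inside the logarithm makes \<open>u\<close> nonnegative and covers zeros of \<open>f\<close>;
    \<open>Suc\<close> avoids level 0.\<close>
  define u where "u n t = ln (max 1 (norm (f t) / real (Suc n)))" for n t
  have um: "u n \<in> borel_measurable circle_measure" for n unfolding u_def by measurable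
  have u0: "0 \<le> u n t" for n t by (simp add: u_def)
  have ule: "(u n t)\<^sup>2 \<le> 4 * (1 + norm (f t))" for n t
  proof -
    have "(u n t)\<^sup>2 \<le> 4 * max 1 (norm (f t) / real (Suc n))" unfolding u_def by (rule ln_sq_le) simp
    also have "norm (f t) / real (Suc n) \<le> norm (f t) / 1" by (intro divide_left_mono) auto
    then have "4 * max 1 (norm (f t) / real (Suc n)) \<le> 4 * (1 + norm (f t))"
      using norm_ge_zero[of "f t"] by (simp only: max_def) (auto split: if_splits)
    finally show ?thesis .
  qed
  have wi: "integrable circle_measure (\<lambda>t. 4 * (1 + norm (f t)))" using f by auto
  have u2: "integrable circle_measure (\<lambda>t. (u n t)\<^sup>2)" for n
    by (rule Bochner_Integration.integrable_bound[OF wi]) (use um[of n] ule[of n] in \<open>auto intro: order_trans\<close>)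
  have lim: "(\<lambda>n. LINT t|circle_measure. (u n t)\<^sup>2) \<longlonglongrightarrow> (LINT t|circle_measure. 0)"
  proof (rule integral_dominated_convergence[OF _ _ wi])
    show "AE t in circle_measure. (\<lambda>n. (u n t)\<^sup>2) \<longlonglongrightarrow> 0"
    proof (rule AE_I2)
      fix t
      have "\<forall>\<^sub>F n in sequentially. (u n t)\<^sup>2 = 0"
        using eventually_ge_at_top[of "nat \<lceil>norm (f t)\<rceil>"]
      proof eventually_elim
        case (elim n)
        then have "norm (f t) / real (Suc n) \<le> 1" by (simp add: field_simps)
        then show ?case by (simp add: u_def max_def)
      qed
      then show "(\<lambda>n. (u n t)\<^sup>2) \<longlonglongrightarrow> 0" by (rule tendsto_eventually)
    qed
  qed (use um ule in auto)
  let ?outer = "\<lambda>P \<phi> n. \<phi> \<in> borel_measurable circle_measure \<and>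
    (\<forall>k. \<forall>t\<in>sphere 0 1. 0 \<le> Re (poly (P k) t)) \<and>
    (AE t in circle_measure. (\<lambda>k. exp (- poly (P k) t)) \<longlonglongrightarrow> \<phi> t) \<and>
    (AE t in circle_measure. norm (\<phi> t) = exp (- u n t)) \<and>
    (LINT t|circle_measure. (norm (1 - \<phi> t))\<^sup>2) \<le> 4 * (LINT t|circle_measure. (u n t)\<^sup>2)"
  have "\<exists>\<phi> P. ?outer P \<phi> n" for n
    by (rule outer_function_exists[OF um[of n] u0 u2]) blast
  then have "\<exists>\<phi>. \<forall>n. \<exists>P. ?outer P (\<phi> n) n" by (intro choice allI)
  then obtain \<phi> where \<phi>: "\<And>n. \<exists>P. ?outer P (\<phi> n) n" by blast
  have \<phi>m: "\<phi> n \<in> borel_measurable circle_measure" for n using \<phi>[of n] by blast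
  have \<phi>n: "AE t in circle_measure. norm (\<phi> n t) = exp (- u n t)" for n using \<phi>[of n] by blast
  have \<phi>2: "(LINT t|circle_measure. (norm (1 - \<phi> n t))\<^sup>2) \<le> 4 * (LINT t|circle_measure. (u n t)\<^sup>2)" for n
    using \<phi>[of n] by blast
  have coeff: "fourier_coeff (\<lambda>t. f t * \<phi> n t) m = 0" if "m < 0" for n m
  proof -
    obtain P where P: "?outer P (\<phi> n) n" using \<phi> by blast
    show ?thesis
    proof (rule fourier_coeff_mult_limit(2)[OF f, of "\<lambda>k t. exp (- poly (P k) t)" 1])
      show "fourier_coeff (\<lambda>t. f t * exp (- poly (P k) t)) m = 0" for k
        using fourier_coeff_mult_exp_poly[OF f neg that, of "- P k"] by simp
      show "(\<lambda>t. exp (- poly (P k) t)) \<in> borel_measurable circle_measure" for k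
        by (intro measurable_circle_measure borel_measurable_continuous_onI continuous_intros)
    qed (use P in auto)
  qed
  have le1: "AE t in circle_measure. norm (\<phi> n t) \<le> 1" for n
    using \<phi>n[of n] by eventually_elim (use u0 in simp)
  have le4: "AE t in circle_measure. norm ((norm (1 - \<phi> n t))\<^sup>2) \<le> 4" for n
    using le1[of n]
  proof eventually_elim
    case (elim t)
    then have "norm (1 - \<phi> n t) \<le> 2" using norm_triangle_ineq4[of 1 "\<phi> n t"] by simp
    then have "(norm (1 - \<phi> n t))\<^sup>2 \<le> 2\<^sup>2" by (intro power_mono) auto
    then show ?case by simp
  qed
  have i2: "integrable circle_measure (\<lambda>t. (norm (1 - \<phi> n t))\<^sup>2)" for n
    by (rule circle.integrable_const_bound[OF le4]) (use \<phi>m[of n] in measurable)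
  \<comment> \<open>Convergence of the moduli to 1 would leave the phase of \<open>\<phi> n\<close>
    free. The L2 bound on \<open>1 - \<phi> n\<close> settles it, and a subsequence then converges
    to 1 almost everywhere.\<close>
  have "(\<lambda>n. LINT t|circle_measure. norm ((norm (1 - \<phi> n t))\<^sup>2)) \<longlonglongrightarrow> 0"
    by (rule tendsto_sandwich[OF _ _ tendsto_const tendsto_mult_right_zero[OF lim[simplified], of 4]])
       (use \<phi>2 in auto)
  then obtain s where s: "strict_mono s" "AE t in circle_measure. (\<lambda>n. (norm (1 - \<phi> (s n) t))\<^sup>2) \<longlonglongrightarrow> 0"
    using tendsto_L1_AE_subseq[of circle_measure "\<lambda>n t. (norm (1 - \<phi> n t))\<^sup>2"] i2 by blast
  show ?thesis
  proof
    fix k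
    show "(\<lambda>t. f t * \<phi> (s k) t) \<in> borel_measurable circle_measure" using \<phi>m[of "s k"] by measurable
    show "fourier_coeff (\<lambda>t. f t * \<phi> (s k) t) n = 0" if "n < 0" for n by (rule coeff[OF that])
    show "AE t in circle_measure. norm (f t * \<phi> (s k) t) \<le> norm (f t)"
      using le1[of "s k"] by eventually_elim (simp add: norm_mult mult_left_le)
    have "AE t in circle_measure. norm (f t * \<phi> (s k) t) \<le> real (Suc (s k))"
      using \<phi>n[of "s k"]
    proof eventually_elim
      case (elim t)
      let ?x = "norm (f t) / real (Suc (s k))"
      have "norm (f t * \<phi> (s k) t) = norm (f t) / max 1 ?x"
        using elim by (simp add: norm_mult u_def exp_minus divide_inverse)
      also have "\<dots> \<le> real (Suc (s k))"
      proof -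
        have "norm (f t) = ?x * real (Suc (s k))" by simp
        also have "\<dots> \<le> max 1 ?x * real (Suc (s k))" by (intro mult_right_mono) auto
        finally show ?thesis by (subst pos_divide_le_eq) (auto simp: mult.commute)
      qed
      finally show ?case .
    qed
    then show "\<exists>B. AE t in circle_measure. norm (f t * \<phi> (s k) t) \<le> B" by blast
  next
    show "AE t in circle_measure. (\<lambda>k. f t * \<phi> (s k) t) \<longlonglongrightarrow> f t"
      using s(2)
    proof eventually_elim
      case (elim t)
      then have "(\<lambda>n. sqrt ((norm (1 - \<phi> (s n) t))\<^sup>2)) \<longlonglongrightarrow> sqrt 0" by (intro tendsto_intros)
      then have "(\<lambda>n. 1 - \<phi> (s n) t) \<longlonglongrightarrow> 0" by (simp add: tendsto_norm_zero_iff)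
      then have "(\<lambda>n. f t * (1 - (1 - \<phi> (s n) t))) \<longlonglongrightarrow> f t * (1 - 0)" by (intro tendsto_intros)
      then show ?case by simp
    qed
  qed
qed

subsection \<open>Variable Lebesgue spaces with bounded exponent\<close>

lemma modular_eq_nn_integral:
  assumes p: "p \<in> borel_measurable circle_measure" and fin: "AE t in circle_measure. p t < \<infinity>"
    and f: "f \<in> borel_measurable circle_measure"
  shows "modular p f = (\<integral>\<^sup>+t. ennreal (norm (f t) powr enn2real (p t)) \<partial>circle_measure)"
proof -
  have A: "infinity_set p \<in> sets circle_measure"
  proof -
    have "infinity_set p = {t \<in> space circle_measure. p t = \<infinity>}"
      by (simp add: infinity_set_def space_circle_measure)
    then show ?thesis using p by simp
  qed
  have "AE t in circle_measure. t \<notin> infinity_set p"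
    using fin by eventually_elim (auto simp: infinity_set_def)
  \<comment> \<open>The restricted measure is null, so 0 is an essential upper bound there and the
    second summand of the modular vanishes.\<close>
  then have "AE t in restrict_space circle_measure (infinity_set p). ennreal (norm (f t)) \<le> 0"
    using A by (subst AE_restrict_space_iff) (auto simp: Int_absorb2 sets.sets_into_space elim: eventually_mono)
  then have "esssup (restrict_space circle_measure (infinity_set p)) (\<lambda>t. ennreal (norm (f t))) \<le> 0"
    using f by (intro esssup_I) (auto intro!: measurable_restrict_space1)
  moreover have "(\<integral>\<^sup>+t\<in>sphere 0 1 - infinity_set p. ennreal (norm (f t) powr enn2real (p t)) \<partial>circle_measure)
      = (\<integral>\<^sup>+t. ennreal (norm (f t) powr enn2real (p t)) \<partial>circle_measure)"
  proof (rule nn_integral_cong_AE)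
    show "AE t in circle_measure. ennreal (norm (f t) powr enn2real (p t)) * indicator (sphere 0 1 - infinity_set p) t
      = ennreal (norm (f t) powr enn2real (p t))"
      using fin circle_ae_norm by eventually_elim (auto simp: infinity_set_def indicator_def)
  qed
  ultimately show ?thesis by (simp add: modular_def)
qed

context
  fixes p :: "complex \<Rightarrow> ennreal" and K :: real
  assumes p: "p \<in> exponents" and K: "AE t in circle_measure. p t \<le> ennreal K"
begin

private lemma pm [measurable]: "p \<in> borel_measurable circle_measure"
  using p by (simp add: exponents_def)

text \<open>\<open>ennreal\<close> sends negative \<open>K\<close> to 0; \<open>max K 1\<close> is a
  real bound whatever the sign of \<open>K\<close>.\<close>

private lemma exponent_bounds: "AE t in circle_measure. p t < \<infinity> \<and> 1 \<le> enn2real (p t) \<and> enn2real (p t) \<le> max K 1"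
  using K circle_ae_norm
proof eventually_elim
  case (elim t)
  then have 1: "1 \<le> p t" using p by (simp add: exponents_def)
  have fin: "p t < \<infinity>" using elim(1) by (simp add: le_less_trans)
  have ge1: "1 \<le> enn2real (p t)" using enn2real_mono[OF 1] fin by simp
  have "enn2real (p t) \<le> enn2real (ennreal K)" using elim by (intro enn2real_mono) auto
  also have "enn2real (ennreal K) \<le> max K 1" by (cases "K \<ge> 0") (auto simp: ennreal_neg)
  finally show ?case using fin ge1 by blast
qed

private lemma modular_div:
  assumes [measurable]: "f \<in> borel_measurable circle_measure" and c: "c > 0"
  shows "modular p (\<lambda>t. f t / complex_of_real c)
    = (\<integral>\<^sup>+t. ennreal ((norm (f t) / c) powr enn2real (p t)) \<partial>circle_measure)"
proof -
  have "AE t in circle_measure. p t < \<infinity>" using exponent_bounds by eventually_elim simp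
  then show ?thesis using c by (subst modular_eq_nn_integral) (auto simp: norm_divide)
qed

text \<open>For \<open>x >= 0\<close> and exponent \<open>r >= 1\<close> one has
  \<open>x <= 1 + x powr r\<close>, and the circle has total mass 1.\<close>

lemma Lvar_integrable:
  assumes f: "f \<in> Lvar p" shows "integrable circle_measure f"
proof -
  from f obtain c where [measurable]: "f \<in> borel_measurable circle_measure" and c: "c > 0"
    "modular p (\<lambda>t. f t / complex_of_real c) < \<infinity>" by (auto simp: Lvar_def)
  have fin: "(\<integral>\<^sup>+t. ennreal ((norm (f t) / c) powr enn2real (p t)) \<partial>circle_measure) < \<infinity>"
    using c by (simp add: modular_div)
  have "(\<integral>\<^sup>+t. norm (f t) \<partial>circle_measure)
    \<le> (\<integral>\<^sup>+t. ennreal c * (1 + ennreal ((norm (f t) / c) powr enn2real (p t))) \<partial>circle_measure)"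
  proof (rule nn_integral_mono_AE)
    show "AE t in circle_measure. ennreal (norm (f t)) \<le> ennreal c * (1 + ennreal ((norm (f t) / c) powr enn2real (p t)))"
      using exponent_bounds
    proof eventually_elim
      case (elim t)
      have "norm (f t) / c \<le> 1 + (norm (f t) / c) powr enn2real (p t)"
      proof (cases "norm (f t) / c \<le> 1")
        case False
        then have "(norm (f t) / c) powr 1 \<le> (norm (f t) / c) powr enn2real (p t)"
          using elim by (intro powr_mono) auto
        with False c show ?thesis by simp
      qed (simp add: add_increasing2)
      then have "norm (f t) \<le> c * (1 + (norm (f t) / c) powr enn2real (p t))"
        using c by (simp add: field_simps)
      then have "ennreal (norm (f t)) \<le> ennreal (c * (1 + (norm (f t) / c) powr enn2real (p t)))"
        by (rule ennreal_leI)
      then show ?case using c by (simp add: ennreal_mult)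
    qed
  qed
  also have "\<dots> = ennreal c * (1 + (\<integral>\<^sup>+t. ennreal ((norm (f t) / c) powr enn2real (p t)) \<partial>circle_measure))"
    by (simp add: nn_integral_cmult nn_integral_add circle.emeasure_space_1)
  also have "\<dots> < \<infinity>" using fin by (simp add: ennreal_mult_less_top)
  finally show ?thesis by (intro integrableI_bounded) auto
qed

lemma bounded_in_Lvar:
  assumes f: "f \<in> borel_measurable circle_measure" and B: "AE t in circle_measure. norm (f t) \<le> B"
  shows "f \<in> Lvar p"
proof -
  define c where "c = max B 1"
  have c: "c > 0" by (simp add: c_def)
  have "(\<integral>\<^sup>+t. ennreal ((norm (f t) / c) powr enn2real (p t)) \<partial>circle_measure) \<le> (\<integral>\<^sup>+t. 1 \<partial>circle_measure)"
  proof (rule nn_integral_mono_AE)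
    show "AE t in circle_measure. ennreal ((norm (f t) / c) powr enn2real (p t)) \<le> 1"
      using B
    proof eventually_elim
      case (elim t)
      then have "norm (f t) / c \<le> 1" using c by (simp add: c_def)
      then have "(norm (f t) / c) powr enn2real (p t) \<le> 1 powr enn2real (p t)"
        using c by (intro powr_mono2) auto
      then show ?case by (simp add: ennreal_le_1)
    qed
  qed
  also have "\<dots> < \<infinity>" by (simp add: circle.emeasure_space_1)
  finally show ?thesis unfolding Lvar_def using modular_div[OF f c] f c by auto
qed

text \<open>Membership of \<open>F\<close> gives a finite modular at one scale \<open>c\<close>, but
  convergence is wanted at every scale \<open>d\<close>. The bounded exponent makes the change of
  scale cost at most the constant factor \<open>m\<close>.\<close>

lemma modular_dominated_convergence:
  assumes F: "F \<in> Lvar p" and h: "\<And>k. h k \<in> borel_measurable circle_measure"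
    and le: "\<And>k. AE t in circle_measure. norm (h k t) \<le> norm (F t)"
    and lim: "AE t in circle_measure. (\<lambda>k. h k t) \<longlonglongrightarrow> 0" and d: "d > 0"
  shows "(\<lambda>k. modular p (\<lambda>t. h k t / complex_of_real d)) \<longlonglongrightarrow> 0"
proof -
  from F obtain c where [measurable]: "F \<in> borel_measurable circle_measure" and c: "c > 0"
    "modular p (\<lambda>t. F t / complex_of_real c) < \<infinity>" by (auto simp: Lvar_def)
  note [measurable] = h
  define m where "m = max 1 (c / d) powr max K 1"
  have fin: "(\<integral>\<^sup>+t. ennreal ((norm (F t) / c) powr enn2real (p t)) \<partial>circle_measure) < \<infinity>"
    using c by (simp add: modular_div)
  have "(\<lambda>k. \<integral>\<^sup>+t. ennreal ((norm (h k t) / d) powr enn2real (p t)) \<partial>circle_measure) \<longlonglongrightarrow> (\<integral>\<^sup>+t. 0 \<partial>circle_measure)"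
  proof (rule nn_integral_dominated_convergence)
    let ?w = "\<lambda>t. ennreal m * ennreal ((norm (F t) / c) powr enn2real (p t))"
    show "?w \<in> borel_measurable circle_measure" by measurable
    show "(\<integral>\<^sup>+t. ?w t \<partial>circle_measure) < \<infinity>"
      using fin by (simp add: nn_integral_cmult ennreal_mult_less_top)
    show "AE t in circle_measure. ennreal ((norm (h k t) / d) powr enn2real (p t)) \<le> ?w t" for k
      using le[of k] exponent_bounds
    proof eventually_elim
      case (elim t)
      have "(norm (h k t) / d) powr enn2real (p t) \<le> ((c / d) * (norm (F t) / c)) powr enn2real (p t)"
        using elim c d by (intro powr_mono2) (auto simp: divide_right_mono)
      also have "\<dots> = (c / d) powr enn2real (p t) * (norm (F t) / c) powr enn2real (p t)"
        using c d by (intro powr_mult)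
      also have "(c / d) powr enn2real (p t) \<le> max 1 (c / d) powr enn2real (p t)"
        using c d by (intro powr_mono2) auto
      also have "\<dots> \<le> m" unfolding m_def using elim by (intro powr_mono) auto
      finally have "(norm (h k t) / d) powr enn2real (p t) \<le> m * (norm (F t) / c) powr enn2real (p t)"
        by (simp add: mult_right_mono)
      then show ?case by (simp add: m_def flip: ennreal_mult)
    qed
    show "AE t in circle_measure. (\<lambda>k. ennreal ((norm (h k t) / d) powr enn2real (p t))) \<longlonglongrightarrow> 0"
      using lim exponent_bounds
    proof eventually_elim
      case (elim t)
      have "(\<lambda>k. norm (h k t) / d) \<longlonglongrightarrow> 0"
        using tendsto_divide[OF tendsto_norm_zero[OF elim(1)] tendsto_const[of d]] d by simp
      then have "(\<lambda>k. (norm (h k t) / d) powr enn2real (p t)) \<longlonglongrightarrow> 0"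
        using elim d by (intro tendsto_zero_powrI[OF _ tendsto_const]) auto
      from tendsto_ennrealI[OF this] show ?case by simp
    qed
  qed auto
  then show ?thesis using d by (simp add: modular_div h)
qed

text \<open>At the doubled scale the sum becomes an average, which is at most the maximum of the two
  terms; a power of the maximum is at most the sum of the powers.\<close>

lemma modular_triangle:
  assumes [measurable]: "f \<in> borel_measurable circle_measure" "g \<in> borel_measurable circle_measure" and d: "d > 0"
  shows "modular p (\<lambda>t. (f t + g t) / complex_of_real (2 * d))
    \<le> modular p (\<lambda>t. f t / complex_of_real d) + modular p (\<lambda>t. g t / complex_of_real d)"
proof -
  have "(\<integral>\<^sup>+t. ennreal ((norm (f t + g t) / (2 * d)) powr enn2real (p t)) \<partial>circle_measure)
    \<le> (\<integral>\<^sup>+t. ennreal ((norm (f t) / d) powr enn2real (p t)) + ennreal ((norm (g t) / d) powr enn2real (p t)) \<partial>circle_measure)"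
  proof (rule nn_integral_mono)
    fix t
    let ?a = "norm (f t) / d" and ?b = "norm (g t) / d"
    have "norm (f t + g t) / (2 * d) \<le> (?a + ?b) / 2"
      using d norm_triangle_ineq[of "f t" "g t"] by (simp add: field_simps)
    also have "\<dots> \<le> max ?a ?b" by argo
    finally have "(norm (f t + g t) / (2 * d)) powr enn2real (p t) \<le> (max ?a ?b) powr enn2real (p t)"
      using d by (intro powr_mono2) auto
    also have "\<dots> \<le> ?a powr enn2real (p t) + ?b powr enn2real (p t)" by (auto simp: max_def)
    finally show "ennreal ((norm (f t + g t) / (2 * d)) powr enn2real (p t))
        \<le> ennreal (?a powr enn2real (p t)) + ennreal (?b powr enn2real (p t))"
      by (simp flip: ennreal_plus add: ennreal_leI)
  qed
  also have "\<dots> = (\<integral>\<^sup>+t. ennreal ((norm (f t) / d) powr enn2real (p t)) \<partial>circle_measure)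
      + (\<integral>\<^sup>+t. ennreal ((norm (g t) / d) powr enn2real (p t)) \<partial>circle_measure)"
    by (rule nn_integral_add) measurable
  finally show ?thesis
    using modular_div[of "\<lambda>t. f t + g t" "2 * d"] modular_div[of f d] modular_div[of g d] d by simp
qed

lemma polynomials_subset_Hardy: "analytic_polynomials \<subseteq> Hardy (Lvar p)"
proof
  fix f assume "f \<in> analytic_polynomials"
  then obtain q where f: "f = poly q" by (auto simp: analytic_polynomials_def)
  obtain B where "\<And>t. t \<in> sphere 0 1 \<Longrightarrow> norm (poly q t) \<le> B" by (rule bounded_poly_sphere[of q]) blast
  then have "poly q \<in> Lvar p"
    by (intro bounded_in_Lvar[of _ B]) (auto simp: space_circle_measure)
  \<comment> \<open>The polynomial is treated as the product of the constant function 1 with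
    \<open>q\<close>.\<close>
  moreover have "fourier_coeff (poly q) n = 0" if "n < 0" for n
    using fourier_coeff_mult_poly[of "\<lambda>t. 1" n q] fourier_coeff_power_int[of 1 0] that by simp
  ultimately show "f \<in> Hardy (Lvar p)" by (simp add: Hardy_def f)
qed

theorem polynomials_dense_Hardy:
  assumes f: "f \<in> Hardy (Lvar p)" and \<epsilon>: "\<epsilon> > 0"
  shows "\<exists>q\<in>analytic_polynomials. Lvar_norm p (\<lambda>t. f t - q t) < \<epsilon>"
proof -
  \<comment> \<open>A modular at most 1 at scale \<open>2 * d\<close> bounds the norm by
    \<open>\<epsilon> / 2\<close>, which leaves room for the strict inequality.\<close>
  define d where "d = \<epsilon> / 4"
  have d: "d > 0" using \<epsilon> by (simp add: d_def)
  have half: "(0::ennreal) < 1 / 2" by (simp add: ennreal_zero_less_divide)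
  have fL: "f \<in> Lvar p" and neg: "\<And>n. n < 0 \<Longrightarrow> fourier_coeff f n = 0" using f by (auto simp: Hardy_def)
  have fm[measurable]: "f \<in> borel_measurable circle_measure" using fL by (simp add: Lvar_def)
  obtain g where g: "\<And>k. g k \<in> borel_measurable circle_measure"
    "\<And>k n. n < 0 \<Longrightarrow> fourier_coeff (g k) n = 0"
    "\<And>k. AE t in circle_measure. norm (g k t) \<le> norm (f t)"
    "\<And>k. \<exists>B. AE t in circle_measure. norm (g k t) \<le> B"
    "AE t in circle_measure. (\<lambda>k. g k t) \<longlonglongrightarrow> f t"
    using bounded_analytic_approx[OF Lvar_integrable[OF fL] neg] by blast
  \<comment> \<open>The majorant for \<open>f - g k\<close>, since \<open>g k\<close> is dominated
    by \<open>f\<close>; doubling the scale compensates the factor 2.\<close>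
  have f2: "(\<lambda>t. 2 * f t) \<in> Lvar p"
  proof -
    obtain c where c: "c > 0" "modular p (\<lambda>t. f t / complex_of_real c) < \<infinity>" using fL by (auto simp: Lvar_def)
    have "(\<lambda>t. 2 * f t / complex_of_real (2 * c)) = (\<lambda>t. f t / complex_of_real c)" by auto
    then show ?thesis using c fm unfolding Lvar_def
      by (auto intro!: exI[of _ "2 * c"] simp del: of_real_mult)
  qed
  have "(\<lambda>k. modular p (\<lambda>t. (f t - g k t) / complex_of_real d)) \<longlonglongrightarrow> 0"
  proof (rule modular_dominated_convergence[OF f2 _ _ _ d])
    show "(\<lambda>t. f t - g k t) \<in> borel_measurable circle_measure" for k using g(1)[of k] by measurable
    show "AE t in circle_measure. norm (f t - g k t) \<le> norm (2 * f t)" for k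
      using g(3)[of k]
    proof eventually_elim
      case (elim t)
      then show ?case using norm_triangle_ineq4[of "f t" "g k t"] by (simp add: norm_mult)
    qed
    show "AE t in circle_measure. (\<lambda>k. f t - g k t) \<longlonglongrightarrow> 0"
      using g(5)
    proof eventually_elim
      case (elim t)
      show ?case using tendsto_diff[OF tendsto_const[of "f t"] elim] by simp
    qed
  qed
  from order_tendstoD(2)[OF this half] obtain k where k: "modular p (\<lambda>t. (f t - g k t) / complex_of_real d) < 1/2"
    by (auto simp: eventually_sequentially)
  obtain B where B: "AE t in circle_measure. norm (g k t) \<le> B" using g(4) by blast
  have gi: "integrable circle_measure (g k)" by (rule circle.integrable_const_bound[OF B g(1)])
  \<comment> \<open>\<open>Suc\<close> keeps the order positive, as \<open>norm_fejer_bound\<close>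
    requires.\<close>
  have "(\<lambda>n. LINT t|circle_measure. norm (fejer (Suc n) (g k) t - g k t)) \<longlonglongrightarrow> 0"
    using fejer_L1_tendsto[OF gi] by (rule LIMSEQ_Suc)
  then obtain s where s: "strict_mono s" "AE t in circle_measure. (\<lambda>n. fejer (Suc (s n)) (g k) t - g k t) \<longlonglongrightarrow> 0"
    using tendsto_L1_AE_subseq[of circle_measure "\<lambda>n t. fejer (Suc n) (g k) t - g k t"] gi integrable_fejer
    by blast
  have "(\<lambda>n. modular p (\<lambda>t. (g k t - fejer (Suc (s n)) (g k) t) / complex_of_real d)) \<longlonglongrightarrow> 0"
  proof (rule modular_dominated_convergence[OF _ _ _ _ d])
    show "(\<lambda>t. complex_of_real (2 * B)) \<in> Lvar p" by (rule bounded_in_Lvar[of _ "\<bar>2 * B\<bar>"]) auto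
    show "(\<lambda>t. g k t - fejer (Suc (s n)) (g k) t) \<in> borel_measurable circle_measure" for n
      using g(1)[of k] by measurable
    show "AE t in circle_measure. norm (g k t - fejer (Suc (s n)) (g k) t) \<le> norm (complex_of_real (2 * B))" for n
      using B circle_ae_norm
    proof eventually_elim
      case (elim t)
      then have "norm (fejer (Suc (s n)) (g k) t) \<le> B" by (intro norm_fejer_bound[OF g(1) B]) auto
      then show ?case using elim norm_triangle_ineq4[of "g k t" "fejer (Suc (s n)) (g k) t"]
        by (simp add: norm_mult)
    qed
    show "AE t in circle_measure. (\<lambda>n. g k t - fejer (Suc (s n)) (g k) t) \<longlonglongrightarrow> 0"
      using s(2)
    proof eventually_elim
      case (elim t)
      show ?case using tendsto_minus[OF elim] by simp
    qed
  qed
  from order_tendstoD(2)[OF this half] obtain n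
    where n: "modular p (\<lambda>t. (g k t - fejer (Suc (s n)) (g k) t) / complex_of_real d) < 1/2"
    by (auto simp: eventually_sequentially)
  obtain q where q: "\<And>t. fejer (Suc (s n)) (g k) t = poly q t"
    using fejer_analytic[of "g k" "Suc (s n)"] g(2)[of _ k] by blast
  have "modular p (\<lambda>t. (f t - poly q t) / complex_of_real (2 * d))
    \<le> modular p (\<lambda>t. (f t - g k t) / complex_of_real d) + modular p (\<lambda>t. (g k t - poly q t) / complex_of_real d)"
    using modular_triangle[of "\<lambda>t. f t - g k t" "\<lambda>t. g k t - poly q t", OF _ _ d] g(1)[of k] by simp
  also have "\<dots> \<le> 1/2 + 1/2" using k n by (intro add_mono) (auto simp: q)
  also have "1/2 + 1/2 = (1::ennreal)"
    by (simp add: ennreal_divide_self flip: add_divide_distrib_ennreal)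
  finally have "Lvar_norm p (\<lambda>t. f t - poly q t) \<le> 2 * d"
    unfolding Lvar_norm_def using d by (intro cInf_lower bdd_belowI[of _ 0]) auto
  then have "Lvar_norm p (\<lambda>t. f t - poly q t) < \<epsilon>" using \<epsilon> by (simp add: d_def)
  then show ?thesis by (auto simp: analytic_polynomials_def)
qed

end

section \<open>Upper bounds for the exponent\<close>

text \<open>If the conjugate exponent is at least \<open>b > 1\<close> almost everywhere, then
  \<open>1 / p >= 1 - 1 / b\<close>, that is \<open>p <= b / (b - 1)\<close>.\<close>

lemma conjugate_exponent_bounded:
  assumes pq: "conjugate_exponents p q" and q: "1 < essinf circle_measure q"
  shows "\<exists>K. AE t in circle_measure. p t \<le> ennreal K"
proof -
  obtain c where c: "1 < c" "AE t in circle_measure. c \<le> q t"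
    using q unfolding essinf_def less_Sup_iff by auto
  \<comment> \<open>The lower bound \<open>c\<close> may be infinite; a finite \<open>b\<close>
    allows real arithmetic.\<close>
  obtain b where b: "1 < b" "ennreal b \<le> c"
  proof (cases c)
    case (real r)
    then show ?thesis using c(1) that[of r] by simp
  qed (use that[of 2] in auto)
  have "p \<in> exponents" using pq unfolding conjugate_exponents_def by blast
  then have ge1: "\<forall>t\<in>sphere 0 1. 1 \<le> p t" unfolding exponents_def by blast
  have "AE t in circle_measure. 1 / p t + 1 / q t = 1"
    using pq by (simp add: conjugate_exponents_def)
  then have "AE t in circle_measure. p t \<le> ennreal (b / (b - 1))"
    using c(2) circle_ae_norm
  proof eventually_elim
    case (elim t)
    have 1: "1 \<le> p t" using ge1 elim(3) by simp
    have bq: "ennreal b \<le> q t" using b(2) elim(2) by (rule order_trans)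
    show ?case
    proof (cases "p t")
      case (real x)
      then have x: "x \<ge> 1" using 1 by simp
      have "1 / x \<ge> 1 - 1 / b"
      proof (cases "q t")
        case (real y)
        then have y: "b \<le> y" using bq b(1) by simp
        have "ennreal (1 / x + 1 / y) = 1"
          using elim(1) \<open>p t = ennreal x\<close> real x y b(1)
          by (simp add: divide_ennreal[symmetric] flip: ennreal_1)
        then have "1 / x + 1 / y = 1" by simp
        moreover have "1 / y \<le> 1 / b" using y b(1) by (intro divide_left_mono) auto
        ultimately show ?thesis by linarith
      next
        case top
        then have "ennreal (1 / x) = 1"
          using elim(1) \<open>p t = ennreal x\<close> x by (simp add: divide_ennreal[symmetric] flip: ennreal_1)
        then have "1 / x = 1" by simp
        then show ?thesis using b(1) by simp
      qed
      then have "x \<le> b / (b - 1)" using x b(1) by (simp add: field_simps)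
      then show ?thesis using real by (simp add: ennreal_leI)
    next
      case top
      \<comment> \<open>An infinite value of \<open>p\<close> would force \<open>q t = 1\<close>,
        against \<open>q t >= b > 1\<close>.\<close>
      then have "1 / q t = 1" using elim(1) by simp
      then have "q t = 1" by (cases "q t") (use bq b(1) in \<open>auto simp: divide_ennreal simp flip: ennreal_1\<close>)
      then show ?thesis using bq b(1) by simp
    qed
  qed
  then show ?thesis by blast
qed

theorem corollary1p3:
  fixes p p' :: "complex \<Rightarrow> ennreal"
  assumes "p \<in> exponents"
    and "conjugate_exponents p p'"
    and "(esssup circle_measure p < \<infinity> \<and>
            (\<exists>r\<in>LH0. AE t in circle_measure. p t = ennreal (r t)))
         \<or> p' \<in> Kapanadze_Kopaliani"
  shows "analytic_polynomials \<subseteq> Hardy (Lvar p) \<and>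
         (\<forall>f\<in>Hardy (Lvar p). \<forall>\<epsilon>>0. \<exists>q\<in>analytic_polynomials. Lvar_norm p (\<lambda>t. f t - q t) < \<epsilon>)"
proof -
  obtain K where K: "AE t in circle_measure. p t \<le> ennreal K"
    using assms(3)
  proof
    assume "esssup circle_measure p < \<infinity> \<and> (\<exists>r\<in>LH0. AE t in circle_measure. p t = ennreal (r t))"
    \<comment> \<open>Finiteness of the essential supremum makes the passage through
      \<open>enn2real\<close> lossless, so its real value can serve as \<open>K\<close>.\<close>
    then have "ennreal (enn2real (esssup circle_measure p)) = esssup circle_measure p" by simp
    then show ?thesis using that esssup_AE[where M = circle_measure and f = p] by metis
  next
    assume "p' \<in> Kapanadze_Kopaliani"
    then show ?thesis
      using conjugate_exponent_bounded[OF assms(2)] that by (auto simp: Kapanadze_Kopaliani_def)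
  qed
  show ?thesis
    using polynomials_subset_Hardy[OF assms(1) K] polynomials_dense_Hardy[OF assms(1) K] by blast
qed

end
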